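(* Let $(\mathbb{X},d)$ be a complete separable metric space, let $k\ge 1$, and let $\Phi_1,\dots,\Phi_k$ be independent point processes on $\mathbb{X}$ with $\sigma$-finite moment measures. Let $\Phi=\sum_{j=1}^k\Phi_j$, so that $M_\Phi=\sum_{j=1}^kM_{\Phi_j}$, and let $p_j(x)=\frac{\mathrm{d}M_{\Phi_j}}{\mathrm{d}M_\Phi}(x)$ be the Radon--Nikodym derivatives, chosen so that $p_j\ge0$ and $\sum_{j=1}^kp_j=1$. Fix families of Palm distributions of $\Phi,\Phi_1,\dots,\Phi_k$. Then for $M_\Phi$-almost all $x\in\mathbb{X}$, $$\Big(\sum_{j=1}^k\Phi_j\Big)_x\stackrel{d}{=}\Phi_{jx}+\sum_{\ell\ne j}\Phi_\ell\quad\text{with probability } p_j(x),\qquad j=1,\dots,k,$$ i.e. the Palm distribution $\mathsf{P}_\Phi^x$ is the mixture over $j\in\{1,\dots,k\}$, with weights $p_j(x)$, of the laws of $\Phi_{jx}+\sum_{\ell\neq j}\Phi_\ell$, where $\Phi_{jx}\sim\mathsf{P}_{\Phi_j}^x$ is taken independent of $(\Phi_\ell)_{\ell\ne j}$. Moreover, the same holds for the reduced Palm versions: for $M_\Phi$-almost all $x\in\mathbb{X}$, $$\Big(\sum_{j=1}^k\Phi_j\Big)^!_x\stackrel{d}{=}\Phi^!_{jx}+\sum_{\ell\ne j}\Phi_\ell\quad\text{with probability } p_j(x),\qquad j=1,\dots,k,$$ with $\Phi^!_{jx}$ independent of $(\Phi_\ell)_{\ell\neq j}$ (terms with $p_j(x)=0$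 being disregarded).
   Context: Let $\mathcal{X}$ be the Borel $\sigma$-algebra of $\mathbb{X}$. A counting measure is a locally finite measure $\mu$ on $(\mathbb{X},\mathcal{X})$ with $\mu(B)\in\mathbb{N}=\{0,1,2,\dots\}$ for every relatively compact $B\in\mathcal{X}$. $\mathbb{M}_{\mathbb{X}}$ is the set of counting measures and $\mathcal{M}_{\mathbb{X}}$ the smallest $\sigma$-algebra on it making all maps $\mu\mapsto\mu(B)$, $B\in\mathcal{X}$, measurable. A point process is a measurable map $\Phi:(\Omega,\mathcal{A},\mathsf{P})\to(\mathbb{M}_{\mathbb{X}},\mathcal{M}_{\mathbb{X}})$ from a probability space. Its (first) moment measure is $M_\Phi(B)=\mathsf{E}[\Phi(B)]$, $B\in\mathcal{X}$. Its Campbell measure is the measure $\mathcal{C}_\Phi$ on $\mathbb{X}\times\mathbb{M}_{\mathbb{X}}$ determined by $\mathcal{C}_\Phi(B\times L)=\mathsf{E}[\Phi(B)\mathbf{1}_L(\Phi)]$ for $B\in\mathcal{X}$, $L\in\mathcal{M}_{\mathbb{X}}$. If $M_\Phi$ is $\sigma$-finite, a family of Palm distributions of $\Phi$ is a probability kernel $x\mapsto\mathsf{P}_\Phi^x$ from $\mathbb{X}$ to $\mathbb{M}_{\mathbb{X}}$ such that $$\mathcal{C}_\Phi(B\times L)=\int_B\mathsf{P}_\Phi^x(L)\,M_\Phi(\mathrm{d}x)\quad\text{for all } B\in\mathcal{X},\ L\in\mathcal{M}_{\mathbb{X}}.$$ A point process $\Phi_x\sim\mathsf{P}_\Phi^x$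 is called a Palm version of $\Phi$ at $x$. It is known that for $M_\Phi$-almost all $x$ one has $\Phi_x(\{x\})\ge1$ almost surely, so that $\Phi_x^!:=\Phi_x-\delta_x$ is a well-defined point process for such $x$; it is called the reduced Palm version of $\Phi$ at $x$. *)

theory Defs
  imports "HOL-Probability.Probability"
begin

text \<open>Locally finite means that every point has a neighbourhood of finite measure. The
  relatively compact sets alone do not give this in a Polish space that is not locally compact.\<close>

definition counting_measures :: "'a::polish_space measure set" where
  "counting_measures = {\<mu>. sets \<mu> = sets borel \<and>
     (\<forall>x. \<exists>U. open U \<and> x \<in> U \<and> emeasure \<mu> U < \<infinity>) \<and>
     (\<forall>B\<in>sets borel. compact (closure B) \<longrightarrow> emeasure \<mu> B \<in> \<nat>)}"

definition counting_algebra :: "'a::polish_space measure measure" where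
  "counting_algebra =
    (SUP B\<in>sets borel. vimage_algebra counting_measures (\<lambda>\<mu>. emeasure \<mu> B) borel)"

lemma space_counting_algebra: "space counting_algebra = counting_measures"
  by (auto simp: counting_algebra_def space_Sup_eq_UN)

lemma measurable_emeasure_counting_algebra [measurable]:
  "B \<in> sets borel \<Longrightarrow> (\<lambda>\<mu>. emeasure \<mu> B) \<in> borel_measurable counting_algebra"
  by (auto intro!: measurable_Sup1 measurable_vimage_algebra1 simp: counting_algebra_def)

lemma measurable_counting_algebra:
  assumes "\<And>\<omega>. \<omega> \<in> space M \<Longrightarrow> \<Phi> \<omega> \<in> counting_measures"
    and "\<And>B. B \<in> sets borel \<Longrightarrow> (\<lambda>\<omega>. emeasure (\<Phi> \<omega>) B) \<in> borel_measurable M"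
  shows "\<Phi> \<in> M \<rightarrow>\<^sub>M counting_algebra"
  using assms by (auto intro!: measurable_Sup2 measurable_vimage_algebra2 simp: counting_algebra_def)

lemma sets_counting_measures: "\<mu> \<in> counting_measures \<Longrightarrow> sets \<mu> = sets borel"
  by (simp add: counting_measures_def)

lemma sets_point_process:
  assumes "\<Phi> \<in> M \<rightarrow>\<^sub>M counting_algebra" "\<omega> \<in> space M"
  shows "sets (\<Phi> \<omega>) = sets borel"
  using measurable_space[OF assms] by (simp add: space_counting_algebra sets_counting_measures)

definition superposition :: "'i set \<Rightarrow> ('i \<Rightarrow> 'a::polish_space measure) \<Rightarrow> 'a measure" where
  "superposition I \<mu> = measure_of UNIV (sets borel) (\<lambda>B. \<Sum>i\<in>I. emeasure (\<mu> i) B)"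

lemma sets_superposition [simp, measurable_cong]: "sets (superposition I \<mu>) = sets borel"
  using sets.sigma_sets_eq[of borel] by (simp add: superposition_def)

lemma emeasure_superposition:
  assumes "\<And>i. i \<in> I \<Longrightarrow> sets (\<mu> i) = sets borel" and B: "B \<in> sets borel"
  shows "emeasure (superposition I \<mu>) B = (\<Sum>i\<in>I. emeasure (\<mu> i) B)"
proof (rule emeasure_measure_of[OF superposition_def])
  show "countably_additive (sets (superposition I \<mu>)) (\<lambda>B. \<Sum>i\<in>I. emeasure (\<mu> i) B)"
    using assms(1) by (intro countably_additiveI) (simp add: suminf_sum suminf_emeasure)
qed (use B in \<open>auto simp: positive_def\<close>)

lemma superposition_in_counting_measures:
  assumes \<mu>: "\<And>i. i \<in> I \<Longrightarrow> \<mu> i \<in> counting_measures"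
  shows "superposition I \<mu> \<in> counting_measures"
proof -
  have e: "emeasure (superposition I \<mu>) B = (\<Sum>i\<in>I. emeasure (\<mu> i) B)" if "B \<in> sets borel" for B
    using \<mu> that by (intro emeasure_superposition) (auto simp: sets_counting_measures)
  have "\<exists>U. open U \<and> x \<in> U \<and> emeasure (superposition I \<mu>) U < \<infinity>" for x
  proof (cases "finite I")
    case True
    have "\<forall>i\<in>I. \<exists>U. open U \<and> x \<in> U \<and> emeasure (\<mu> i) U < \<infinity>"
      using \<mu> by (auto simp: counting_measures_def)
    then obtain U where U: "\<And>i. i \<in> I \<Longrightarrow> open (U i) \<and> x \<in> U i \<and> emeasure (\<mu> i) (U i) < \<infinity>"
      by metis
    have o: "open (\<Inter>i\<in>I. U i)" using True U by auto
    have "emeasure (\<mu> i) (\<Inter>i\<in>I. U i) < \<infinity>" if "i \<in> I" for i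
    proof -
      have "emeasure (\<mu> i) (\<Inter>i\<in>I. U i) \<le> emeasure (\<mu> i) (U i)"
        using U[OF that] \<mu>[OF that] that
        by (intro emeasure_mono) (auto simp: sets_counting_measures)
      then show ?thesis using U[OF that] by (auto simp: less_top top_unique)
    qed
    then have "emeasure (superposition I \<mu>) (\<Inter>i\<in>I. U i) < \<infinity>"
      using o True by (simp add: e less_top[symmetric])
    then show ?thesis using o U by blast
  next
    case False
    then show ?thesis by (intro exI[of _ UNIV]) (simp add: e)
  qed
  moreover have "emeasure (superposition I \<mu>) B \<in> \<nat>"
    if "B \<in> sets borel" "compact (closure B)" for B
  proof -
    have "emeasure (\<mu> i) B \<in> \<nat>" if "i \<in> I" for i
      using \<mu>[OF that] \<open>B \<in> sets borel\<close> \<open>compact (closure B)\<close> by (auto simp: counting_measures_def)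
    then have "(\<Sum>i\<in>I. emeasure (\<mu> i) B) \<in> \<nat>"
      by (induction I rule: infinite_finite_induct) auto
    with that show ?thesis by (simp add: e)
  qed
  ultimately show ?thesis by (auto simp: counting_measures_def)
qed

text \<open>Removal of one point at \<open>x\<close>. The case without an atom at \<open>x\<close> only makes the
  function total on counting measures: it is a null event for Palm versions.\<close>

definition remove_point :: "'a::polish_space \<Rightarrow> 'a measure \<Rightarrow> 'a measure" where
  "remove_point x \<mu> = (if 1 \<le> emeasure \<mu> {x} then diff_measure \<mu> (return borel x) else \<mu>)"

lemma emeasure_remove_point:
  assumes s: "sets \<mu> = sets borel" and x: "1 \<le> emeasure \<mu> {x}" and B: "B \<in> sets borel"
  shows "emeasure (remove_point x \<mu>) B = emeasure \<mu> B - indicator B x"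
proof -
  have le: "indicator A x \<le> emeasure \<mu> A" if "A \<in> sets borel" for A
  proof (cases "x \<in> A")
    case True
    then have "emeasure \<mu> {x} \<le> emeasure \<mu> A" using that s by (intro emeasure_mono) auto
    with x True show ?thesis by auto
  qed simp
  have "countably_additive (sets \<mu>) (\<lambda>A. emeasure \<mu> A - emeasure (return borel x) A)"
  proof (rule countably_additiveI)
    fix A :: "nat \<Rightarrow> _" assume A: "range A \<subseteq> sets \<mu>" "disjoint_family A"
    let ?h = "\<lambda>i. emeasure \<mu> (A i) - emeasure (return borel x) (A i)"
    have "?h i + emeasure (return borel x) (A i) = emeasure \<mu> (A i)" for i
      using A le[of "A i"] s by (auto simp: subset_eq intro!: diff_add_cancel_ennreal)
    then have "(\<Sum>i. emeasure \<mu> (A i)) = suminf ?h + (\<Sum>i. emeasure (return borel x) (A i))"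
      by (simp add: suminf_add)
    moreover have "(\<Sum>i. emeasure (return borel x) (A i)) \<noteq> \<top>"
    proof -
      have "(\<Sum>i. emeasure (return borel x) (A i)) = emeasure (return borel x) (\<Union>i. A i)"
        using A s by (intro suminf_emeasure) auto
      also have "\<dots> = indicator (\<Union>i. A i) x"
        using A s by (intro emeasure_return) auto
      finally show ?thesis by (simp add: indicator_def)
    qed
    ultimately have "suminf ?h = (\<Sum>i. emeasure \<mu> (A i)) - (\<Sum>i. emeasure (return borel x) (A i))"
      by simp
    also have "\<dots> = emeasure \<mu> (\<Union>i. A i) - emeasure (return borel x) (\<Union>i. A i)"
    proof -
      have "(\<Sum>i. emeasure (return borel x) (A i)) = emeasure (return borel x) (\<Union>i. A i)"
        using A s by (intro suminf_emeasure) auto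
      with A show ?thesis by (simp only: suminf_emeasure)
    qed
    finally show "(\<Sum>i. emeasure \<mu> (A i) - emeasure (return borel x) (A i)) =
      emeasure \<mu> (\<Union>i. A i) - emeasure (return borel x) (\<Union>i. A i)" .
  qed
  then have "emeasure (diff_measure \<mu> (return borel x)) B =
      emeasure \<mu> B - emeasure (return borel x) B"
    using B s unfolding diff_measure_def
    by (intro emeasure_measure_of_sigma sets.sigma_algebra_axioms) (auto simp: positive_def)
  with x B show ?thesis by (simp add: remove_point_def)
qed

definition moment_measure :: "'w measure \<Rightarrow> ('w \<Rightarrow> 'a::polish_space measure) \<Rightarrow> 'a measure" where
  "moment_measure M \<Phi> = measure_of UNIV (sets borel) (\<lambda>B. \<integral>\<^sup>+\<omega>. emeasure (\<Phi> \<omega>) B \<partial>M)"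

lemma sets_moment_measure [simp, measurable_cong]: "sets (moment_measure M \<Phi>) = sets borel"
  using sets.sigma_sets_eq[of borel] by (simp add: moment_measure_def)

lemma emeasure_moment_measure:
  assumes \<Phi> [measurable]: "\<Phi> \<in> M \<rightarrow>\<^sub>M counting_algebra" and B: "B \<in> sets borel"
  shows "emeasure (moment_measure M \<Phi>) B = (\<integral>\<^sup>+\<omega>. emeasure (\<Phi> \<omega>) B \<partial>M)"
proof (rule emeasure_measure_of[OF moment_measure_def])
  show "countably_additive (sets (moment_measure M \<Phi>)) (\<lambda>B. \<integral>\<^sup>+\<omega>. emeasure (\<Phi> \<omega>) B \<partial>M)"
  proof (rule countably_additiveI)
    fix A :: "nat \<Rightarrow> 'b set"
    assume A: "range A \<subseteq> sets (moment_measure M \<Phi>)" "disjoint_family A"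
    then have [measurable]: "A i \<in> sets borel" for i by auto
    have "(\<Sum>i. \<integral>\<^sup>+\<omega>. emeasure (\<Phi> \<omega>) (A i) \<partial>M) = (\<integral>\<^sup>+\<omega>. (\<Sum>i. emeasure (\<Phi> \<omega>) (A i)) \<partial>M)"
      by (rule nn_integral_suminf[symmetric]) measurable
    also have "\<dots> = (\<integral>\<^sup>+\<omega>. emeasure (\<Phi> \<omega>) (\<Union>i. A i) \<partial>M)"
      using A by (intro nn_integral_cong suminf_emeasure) (auto simp: sets_point_process[OF \<Phi>])
    finally show "(\<Sum>i. \<integral>\<^sup>+\<omega>. emeasure (\<Phi> \<omega>) (A i) \<partial>M) = (\<integral>\<^sup>+\<omega>. emeasure (\<Phi> \<omega>) (\<Union>i. A i) \<partial>M)" .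
  qed
qed (use B in \<open>auto simp: positive_def\<close>)

definition campbell_measure ::
    "'w measure \<Rightarrow> ('w \<Rightarrow> 'a::polish_space measure) \<Rightarrow> ('a \<times> 'a measure) measure" where
  "campbell_measure M \<Phi> =
     extend_measure (UNIV \<times> counting_measures)
       (sets borel \<times> sets counting_algebra) (\<lambda>(B, L). B \<times> L)
       (\<lambda>(B, L). \<integral>\<^sup>+\<omega>. emeasure (\<Phi> \<omega>) B * indicator L (\<Phi> \<omega>) \<partial>M)"

lemma campbell_measure_generator:
  shows "(\<lambda>(B, L). B \<times> L) ` (sets borel \<times> sets (counting_algebra :: 'a::polish_space measure measure))
     = {a \<times> b | a b. a \<in> sets (borel :: 'a measure) \<and> b \<in> sets (counting_algebra :: 'a measure measure)}"
    and "{a \<times> b | a b. a \<in> sets (borel :: 'a measure) \<and> b \<in> sets (counting_algebra :: 'a measure measure)}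
     \<subseteq> Pow (UNIV \<times> counting_measures)"
  using sets.sets_into_space[where M="counting_algebra :: 'a measure measure"]
  by (auto simp: space_counting_algebra)

lemma sets_campbell_measure [simp, measurable_cong]:
  "sets (campbell_measure M (\<Phi> :: 'w \<Rightarrow> 'a::polish_space measure)) =
   sets (borel \<Otimes>\<^sub>M counting_algebra)"
  unfolding campbell_measure_def
  by (subst sets_extend_measure)
    (simp_all only: campbell_measure_generator sets_pair_measure space_borel space_counting_algebra)

text \<open>The sections of a measurable set have measurable counting measure. This makes the extension
  defining the Campbell measure exist.\<close>

lemma measurable_emeasure_section_finite:
  fixes A :: "('a::polish_space \<times> 'a measure) set"
  assumes U: "U \<in> sets borel"
    and A: "A \<in> sets (borel \<Otimes>\<^sub>M counting_algebra)"
  shows "(\<lambda>\<mu>. if emeasure \<mu> U < \<infinity> then emeasure \<mu> (U \<inter> (\<lambda>x. (x, \<mu>)) -` A) else 0)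
    \<in> borel_measurable counting_algebra"
    (is "?f A \<in> _")
proof -
  let ?N = "counting_algebra :: 'a measure measure"
  have [measurable]: "U \<in> sets borel" by (fact U)
  let ?G = "{a \<times> b | a b. a \<in> sets (borel :: 'a measure) \<and> b \<in> sets ?N}"
  have st: "(\<lambda>x. (x, \<mu>)) -` C \<in> sets \<mu>"
    if "C \<in> sets (borel \<Otimes>\<^sub>M ?N)" "\<mu> \<in> space ?N" for C \<mu>
  proof -
    have "(\<lambda>x. (x, \<mu>)) \<in> borel \<rightarrow>\<^sub>M borel \<Otimes>\<^sub>M ?N" using that by measurable
    from measurable_sets[OF this that(1)] that(2) show ?thesis
      by (simp add: space_counting_algebra sets_counting_measures)
  qed
  have Us: "U \<in> sets \<mu>" if "\<mu> \<in> space ?N" for \<mu>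
    using that by (simp add: space_counting_algebra sets_counting_measures)
  have "Int_stable ?G" by (rule Int_stable_pair_measure_generator)
  moreover have "?G \<subseteq> Pow (UNIV \<times> space ?N)"
    using pair_measure_closed[of "borel :: 'a measure" ?N] by simp
  moreover have "A \<in> sigma_sets (UNIV \<times> space ?N) ?G"
    using A by (simp add: sets_pair_measure)
  ultimately show ?thesis
  proof (induction rule: sigma_sets_induct_disjoint)
    case (basic C)
    then obtain a b where C: "C = a \<times> b" and [measurable]: "a \<in> sets borel" "b \<in> sets ?N" by auto
    have "?f C = (\<lambda>\<mu>. if emeasure \<mu> U < \<infinity> then emeasure \<mu> (U \<inter> a) * indicator b \<mu> else 0)"
      by (auto simp: C fun_eq_iff vimage_def indicator_def Int_def)
    then show ?case by simp
  next
    case empty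
    show ?case unfolding vimage_empty Int_empty_right emeasure_empty by simp
  next
    case (compl C)
    have C: "C \<in> sets (borel \<Otimes>\<^sub>M ?N)" using compl by (simp add: sets_pair_measure)
    have "?f (UNIV \<times> space ?N - C) \<mu> = (if emeasure \<mu> U < \<infinity> then emeasure \<mu> U - ?f C \<mu> else 0)"
      if \<mu>: "\<mu> \<in> space ?N" for \<mu>
    proof (cases "emeasure \<mu> U < \<infinity>")
      case True
      have "emeasure \<mu> (U \<inter> (\<lambda>x. (x, \<mu>)) -` C) \<le> emeasure \<mu> U"
        by (intro emeasure_mono Us \<mu>) auto
      with True have "emeasure \<mu> (U \<inter> (\<lambda>x. (x, \<mu>)) -` C) \<noteq> \<infinity>" by (auto simp: top_unique)
      moreover have "U \<inter> (\<lambda>x. (x, \<mu>)) -` (UNIV \<times> space ?N - C) = U - U \<inter> (\<lambda>x. (x, \<mu>)) -` C"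
        using \<mu> by auto
      ultimately show ?thesis
        using True Us[OF \<mu>] st[OF C \<mu>] by (simp add: emeasure_Diff)
    qed simp
    note eq = this
    have [measurable]: "?f C \<in> borel_measurable ?N" by (rule compl)
    have "(\<lambda>\<mu>. if emeasure \<mu> U < \<infinity> then emeasure \<mu> U - ?f C \<mu> else 0) \<in> borel_measurable ?N"
      by measurable
    then show ?case by (rule measurable_cong[THEN iffD2, rotated]) (rule eq)
  next
    case (union C)
    have C: "C i \<in> sets (borel \<Otimes>\<^sub>M ?N)" for i using union by (auto simp: sets_pair_measure)
    have "?f (\<Union>i. C i) \<mu> = (\<Sum>i. ?f (C i) \<mu>)" if \<mu>: "\<mu> \<in> space ?N" for \<mu>
    proof (cases "emeasure \<mu> U < \<infinity>")
      case True
      have "disjoint_family (\<lambda>i. U \<inter> (\<lambda>x. (x, \<mu>)) -` C i)"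
        using union(1) by (auto simp: disjoint_family_on_def)
      then have "(\<Sum>i. emeasure \<mu> (U \<inter> (\<lambda>x. (x, \<mu>)) -` C i)) =
          emeasure \<mu> (\<Union>i. U \<inter> (\<lambda>x. (x, \<mu>)) -` C i)"
        using Us[OF \<mu>] st[OF C \<mu>] by (intro suminf_emeasure) auto
      then show ?thesis using True by (simp add: vimage_UN)
    qed simp
    note eq = this
    have "(\<lambda>\<mu>. \<Sum>i. ?f (C i) \<mu>) \<in> borel_measurable ?N"
      by (intro borel_measurable_suminf_order union)
    then show ?case by (rule measurable_cong[THEN iffD2, rotated]) (rule eq)
  qed
qed

lemma measurable_emeasure_section:
  fixes A :: "('a::polish_space \<times> 'a measure) set"
  assumes A [measurable]: "A \<in> sets (borel \<Otimes>\<^sub>M counting_algebra)"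
  shows "(\<lambda>\<mu>. emeasure \<mu> ((\<lambda>x. (x, \<mu>)) -` A)) \<in> borel_measurable counting_algebra"
proof -
  let ?N = "counting_algebra :: 'a measure measure"
  obtain \<B> :: "'a set set" where \<B>: "countable \<B>" "topological_basis \<B>"
    using ex_countable_basis by blast
  have ne: "\<B> \<noteq> {}"
    using topological_basisE[OF \<B>(2) open_UNIV UNIV_I] by blast
  define U where "U = from_nat_into \<B>"
  have U_open: "open (U n)" for n
    using \<B>(2) from_nat_into[OF ne] by (auto simp: U_def topological_basis_open)
  have [measurable]: "U n \<in> sets borel" for n using U_open by simp
  define F where "F n = {z \<in> space (borel \<Otimes>\<^sub>M ?N). fst z \<in> U n \<and> emeasure (snd z) (U n) < \<infinity>}" for n
  have F [measurable]: "F n \<in> sets (borel \<Otimes>\<^sub>M ?N)" for n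
    unfolding F_def by measurable
  define D where "D n = disjointed F n \<inter> A" for n
  have D [measurable]: "D n \<in> sets (borel \<Otimes>\<^sub>M ?N)" for n
    unfolding D_def using sets.range_disjointed_sets[of F "borel \<Otimes>\<^sub>M ?N"] F
    by (intro sets.Int A) (auto simp: image_subset_iff)
  have cover: "\<exists>n. (x, \<mu>) \<in> F n" if \<mu>: "\<mu> \<in> space ?N" for x \<mu>
  proof -
    from \<mu> obtain V where V: "open V" "x \<in> V" "emeasure \<mu> V < \<infinity>"
      unfolding space_counting_algebra counting_measures_def by blast
    obtain W where W: "W \<in> \<B>" "x \<in> W" "W \<subseteq> V" using topological_basisE[OF \<B>(2) V(1,2)] by blast
    obtain n where n: "U n = W"
      using from_nat_into_surj[OF \<B>(1) W(1)] by (auto simp: U_def)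
    have "emeasure \<mu> W \<le> emeasure \<mu> V"
      using W V \<mu> by (intro emeasure_mono) (auto simp: space_counting_algebra sets_counting_measures)
    then have "emeasure \<mu> W < \<infinity>" using V(3) by (rule le_less_trans)
    with W n \<mu> show ?thesis by (auto simp: F_def space_pair_measure)
  qed
  have "emeasure \<mu> ((\<lambda>x. (x, \<mu>)) -` A) =
      (\<Sum>n. if emeasure \<mu> (U n) < \<infinity> then emeasure \<mu> (U n \<inter> (\<lambda>x. (x, \<mu>)) -` D n) else 0)"
    if \<mu>: "\<mu> \<in> space ?N" for \<mu>
  proof -
    have eq: "(\<lambda>x. (x, \<mu>)) -` A = (\<Union>n. (\<lambda>x. (x, \<mu>)) -` D n)"
    proof -
      have DA: "(\<Union>n. D n) = (\<Union>n. F n) \<inter> A"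
        using UN_disjointed_eq[of F] by (auto simp: D_def)
      have "(x, \<mu>) \<in> (\<Union>n. F n)" for x using cover[OF \<mu>, of x] by (elim exE UN_I[OF UNIV_I])
      then have "(\<lambda>x. (x, \<mu>)) -` A = (\<lambda>x. (x, \<mu>)) -` (\<Union>n. D n)"
        by (simp only: DA vimage_def Int_iff simp_thms)
      then show ?thesis by (simp only: vimage_UN)
    qed
    have m: "(\<lambda>x. (x, \<mu>)) -` D n \<in> sets \<mu>" for n
    proof -
      have "(\<lambda>x. (x, \<mu>)) \<in> borel \<rightarrow>\<^sub>M borel \<Otimes>\<^sub>M ?N" using \<mu> by measurable
      from measurable_sets[OF this D] \<mu> show ?thesis
        by (simp add: space_counting_algebra sets_counting_measures)
    qed
    have "disjoint_family (\<lambda>n. (\<lambda>x. (x, \<mu>)) -` D n)"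
      using disjoint_family_disjointed[of F] by (auto simp: D_def disjoint_family_on_def)
    then have "emeasure \<mu> ((\<lambda>x. (x, \<mu>)) -` A) = (\<Sum>n. emeasure \<mu> ((\<lambda>x. (x, \<mu>)) -` D n))"
      unfolding eq using m by (intro suminf_emeasure[symmetric]) auto
    also have "\<dots> = (\<Sum>n. if emeasure \<mu> (U n) < \<infinity> then emeasure \<mu> (U n \<inter> (\<lambda>x. (x, \<mu>)) -` D n) else 0)"
    proof (intro suminf_cong)
      fix n
      have sub: "D n \<subseteq> F n" using disjointed_subset[of F n] by (auto simp: D_def)
      show "emeasure \<mu> ((\<lambda>x. (x, \<mu>)) -` D n) =
        (if emeasure \<mu> (U n) < \<infinity> then emeasure \<mu> (U n \<inter> (\<lambda>x. (x, \<mu>)) -` D n) else 0)"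
      proof (cases "emeasure \<mu> (U n) < \<infinity>")
        case True
        have "(\<lambda>x. (x, \<mu>)) -` D n = U n \<inter> (\<lambda>x. (x, \<mu>)) -` D n" using sub by (auto simp: F_def)
        with True show ?thesis by simp
      next
        case False
        then have "(\<lambda>x. (x, \<mu>)) -` D n = {}" using sub by (auto simp: F_def)
        with False show ?thesis by simp
      qed
    qed
    finally show ?thesis .
  qed
  note eq = this
  have "(\<lambda>\<mu>. \<Sum>n. if emeasure \<mu> (U n) < \<infinity>
      then emeasure \<mu> (U n \<inter> (\<lambda>x. (x, \<mu>)) -` D n) else 0) \<in> borel_measurable ?N"
    by (intro borel_measurable_suminf_order measurable_emeasure_section_finite D \<open>U _ \<in> sets borel\<close>)
  then show ?thesis by (rule measurable_cong[THEN iffD2, rotated]) (rule eq)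
qed

lemma emeasure_campbell_measure:
  fixes \<Phi> :: "'w \<Rightarrow> 'a::polish_space measure"
  assumes \<Phi>: "\<Phi> \<in> M \<rightarrow>\<^sub>M counting_algebra"
    and "B \<in> sets borel" "L \<in> sets counting_algebra"
  shows "emeasure (campbell_measure M \<Phi>) (B \<times> L) =
    (\<integral>\<^sup>+\<omega>. emeasure (\<Phi> \<omega>) B * indicator L (\<Phi> \<omega>) \<partial>M)"
proof -
  let ?N = "counting_algebra :: 'a measure measure"
  let ?m = "\<lambda>A. \<integral>\<^sup>+\<omega>. emeasure (\<Phi> \<omega>) ((\<lambda>x. (x, \<Phi> \<omega>)) -` A) \<partial>M"
  have "countably_additive (sets (campbell_measure M \<Phi>)) ?m"
  proof (rule countably_additiveI)
    fix A :: "nat \<Rightarrow> _" assume A: "range A \<subseteq> sets (campbell_measure M \<Phi>)" "disjoint_family A"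
    then have Am: "A i \<in> sets (borel \<Otimes>\<^sub>M ?N)" for i by auto
    have s: "(\<lambda>x. (x, \<Phi> \<omega>)) -` A i \<in> sets (\<Phi> \<omega>)" if "\<omega> \<in> space M" for \<omega> i
    proof -
      have "(\<lambda>x. (x, \<Phi> \<omega>)) \<in> borel \<rightarrow>\<^sub>M borel \<Otimes>\<^sub>M ?N"
        using measurable_space[OF \<Phi> that] by measurable
      from measurable_sets[OF this Am] show ?thesis
        by (simp add: sets_point_process[OF \<Phi> that])
    qed
    have "(\<Sum>i. ?m (A i)) = (\<integral>\<^sup>+\<omega>. (\<Sum>i. emeasure (\<Phi> \<omega>) ((\<lambda>x. (x, \<Phi> \<omega>)) -` A i)) \<partial>M)"
      by (intro nn_integral_suminf[symmetric] measurable_compose[OF \<Phi> measurable_emeasure_section] Am)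
    also have "\<dots> = ?m (\<Union>i. A i)"
    proof (rule nn_integral_cong)
      fix \<omega> assume \<omega>: "\<omega> \<in> space M"
      have "disjoint_family (\<lambda>i. (\<lambda>x. (x, \<Phi> \<omega>)) -` A i)"
        using A(2) by (auto simp: disjoint_family_on_def)
      then show "(\<Sum>i. emeasure (\<Phi> \<omega>) ((\<lambda>x. (x, \<Phi> \<omega>)) -` A i)) =
          emeasure (\<Phi> \<omega>) ((\<lambda>x. (x, \<Phi> \<omega>)) -` (\<Union>i. A i))"
        using s[OF \<omega>] by (subst suminf_emeasure) (auto simp: vimage_UN)
    qed
    finally show "(\<Sum>i. ?m (A i)) = ?m (\<Union>i. A i)" .
  qed
  moreover have "?m (B \<times> L) = (\<integral>\<^sup>+\<omega>. emeasure (\<Phi> \<omega>) B * indicator L (\<Phi> \<omega>) \<partial>M)" for B L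
    by (intro nn_integral_cong) (auto simp: vimage_def indicator_def)
  moreover have "(\<lambda>(B, L). B \<times> L) ` (sets (borel :: 'a measure) \<times> sets ?N) \<subseteq> Pow (UNIV \<times> counting_measures)"
    by (simp only: campbell_measure_generator)
  ultimately show ?thesis
    using emeasure_extend_measure[OF campbell_measure_def[of M \<Phi>], of ?m "(B, L)"] assms(2,3)
    by (auto simp: positive_def)
qed

definition palm_family ::
    "'w measure \<Rightarrow> ('w \<Rightarrow> 'a::polish_space measure) \<Rightarrow> ('a \<Rightarrow> 'a measure measure) \<Rightarrow> bool" where
  "palm_family M \<Phi> P \<longleftrightarrow>
     P \<in> borel \<rightarrow>\<^sub>M prob_algebra counting_algebra \<and>
     (\<forall>B\<in>sets borel. \<forall>L\<in>sets counting_algebra.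
        emeasure (campbell_measure M \<Phi>) (B \<times> L) =
        (\<integral>\<^sup>+x\<in>B. emeasure (P x) L \<partial>moment_measure M \<Phi>))"

end

theory Submission
  imports Defs
begin

text \<open>The Campbell measure of the sum splits into \<open>E[\<Phi>\<^sub>j(B) 1\<^sub>L(\<Sum>\<^sub>l \<Phi>\<^sub>l)]\<close> over \<open>j\<close>. By independence
  the summands \<open>\<Phi>\<^sub>l\<close> with \<open>l \<noteq> j\<close> can be frozen, and disintegrating \<open>\<Phi>\<^sub>j\<close> along its own Palm
  kernel shows that the mixture of the component laws with weights \<open>p\<^sub>j\<close> is a Palm family of the sum. Palm
  families are unique almost everywhere because the \<open>\<sigma>\<close>-algebra on counting measures is countably
  generated. The reduced version is the image under removal of a point at \<open>x\<close>, which only affects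
  the \<open>j\<close>th summand since \<open>\<Phi>\<^sub>j\<^sub>x\<close> almost surely has an atom at \<open>x\<close>.\<close>

section \<open>Atoms of Palm versions\<close>

text \<open>Integrality is available on relatively compact sets only, and an open set in a Polish
  space need not be one. Inner regularity bridges the gap: every compact
  \<open>K \<subseteq> U\<close> has a natural number below \<open>1\<close> as its mass.\<close>

lemma counting_measure_open_lt_1:
  fixes \<mu> :: "'a::polish_space measure"
  assumes \<mu>: "\<mu> \<in> counting_measures" and U: "open U" and lt: "emeasure \<mu> U < 1"
  shows "emeasure \<mu> U = 0"
proof -
  have s: "sets \<mu> = sets borel" using \<mu> by (rule sets_counting_measures)
  \<comment> \<open>The regularity theorems ask for a finite measure, whereas \<mu> is only locally
    finite, hence the restriction to \<open>U\<close>.\<close>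
  let ?\<nu> = "density \<mu> (indicator U)"
  have \<nu>: "emeasure ?\<nu> B = emeasure \<mu> (U \<inter> B)" if "B \<in> sets borel" for B
    using that U s by (intro emeasure_restricted) auto
  have "emeasure ?\<nu> (space ?\<nu>) = emeasure \<mu> U"
    using \<nu>[of UNIV] sets_eq_imp_space_eq[OF s] by simp
  then have fin: "emeasure ?\<nu> (space ?\<nu>) \<noteq> \<infinity>" using lt by auto
  have "emeasure \<mu> U = emeasure ?\<nu> U" using \<nu>[of U] U by simp
  also have "\<dots> = (SUP K\<in>{K. K \<subseteq> U \<and> compact K}. emeasure ?\<nu> K)"
    using fin s U by (intro inner_regular) auto
  also have "\<dots> = 0"
  proof (rule antisym[OF SUP_least])
    fix K assume "K \<in> {K. K \<subseteq> U \<and> compact K}"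
    then have K: "K \<subseteq> U" "compact K" "K \<in> sets borel" by (auto intro: borel_compact)
    have "emeasure \<mu> K \<in> \<nat>"
      using \<mu> K by (auto simp: counting_measures_def compact_imp_closed closure_closed)
    moreover have "emeasure \<mu> K \<le> emeasure \<mu> U" using K U s by (intro emeasure_mono) auto
    ultimately obtain n :: nat where "emeasure \<mu> K = of_nat n" "of_nat n < (1::ennreal)"
      using lt by (metis Nats_cases le_less_trans)
    moreover from this have "n = 0" by (metis of_nat_1 of_nat_less_iff less_one)
    ultimately show "emeasure ?\<nu> K \<le> 0" using \<nu>[OF K(3)] K(1) by (simp add: Int_absorb1)
  qed simp
  finally show ?thesis .
qed

text \<open>Local finiteness allows restricting \<mu> to a neighbourhood of finite mass; outer
  regularity at \<open>{x}\<close> then yields an open set, which is shrunk to a basic one. A small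
  atom is thus detected by countably many sets.\<close>

lemma ex_basis_emeasure_lt:
  fixes \<mu> :: "'a::polish_space measure"
  assumes \<mu>: "\<mu> \<in> counting_measures" and \<B>: "topological_basis \<B>" and lt: "emeasure \<mu> {x} < c"
  shows "\<exists>W\<in>\<B>. x \<in> W \<and> emeasure \<mu> W < c"
proof -
  have s: "sets \<mu> = sets borel" using \<mu> by (rule sets_counting_measures)
  obtain U where U: "open U" "x \<in> U" "emeasure \<mu> U < \<infinity>"
    using \<mu> unfolding counting_measures_def by blast
  let ?\<nu> = "density \<mu> (indicator U)"
  have \<nu>: "emeasure ?\<nu> B = emeasure \<mu> (U \<inter> B)" if "B \<in> sets borel" for B
    using that U s by (intro emeasure_restricted) auto
  have "emeasure ?\<nu> (space ?\<nu>) = emeasure \<mu> U"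
    using \<nu>[of UNIV] sets_eq_imp_space_eq[OF s] by simp
  then have fin: "emeasure ?\<nu> (space ?\<nu>) \<noteq> \<infinity>" using U by auto
  have "emeasure \<mu> {x} = emeasure ?\<nu> {x}" using \<nu>[of "{x}"] U by simp
  also have "\<dots> = (INF V\<in>{V. {x} \<subseteq> V \<and> open V}. emeasure ?\<nu> V)"
    using fin s by (intro outer_regular) auto
  finally obtain V where V: "x \<in> V" "open V" "emeasure ?\<nu> V < c"
    using lt by (auto simp: INF_less_iff)
  obtain W where W: "W \<in> \<B>" "x \<in> W" "W \<subseteq> U \<inter> V"
    using topological_basisE[OF \<B>, of "U \<inter> V" x] U V by auto
  have "emeasure \<mu> W \<le> emeasure \<mu> (U \<inter> V)" using W U V s by (intro emeasure_mono) auto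
  with W V \<nu>[of V] show ?thesis by (auto intro: le_less_trans)
qed

section \<open>Elementary facts on Palm families\<close>

lemma palm_family_measurable:
  "palm_family M \<Phi> P \<Longrightarrow> P \<in> borel \<rightarrow>\<^sub>M prob_algebra counting_algebra"
  by (simp add: palm_family_def)

lemma palm_family_emeasure_measurable:
  assumes "palm_family M \<Phi> P" "L \<in> sets counting_algebra"
  shows "(\<lambda>x. emeasure (P x) L) \<in> borel_measurable borel"
  using measurable_prob_algebraD[OF palm_family_measurable[OF assms(1)]] assms(2)
  by (rule measurable_emeasure_kernel)

lemma palm_family_kernel:
  assumes "palm_family M \<Phi> P"
  shows "prob_space (P x)" and "sets (P x) = sets counting_algebra"
    and "space (P x) = counting_measures"
proof -
  have *: "P x \<in> space (prob_algebra counting_algebra)"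
    using palm_family_measurable[OF assms] by (rule measurable_space) simp
  then show "prob_space (P x)" "sets (P x) = sets counting_algebra"
    by (auto simp: space_prob_algebra)
  from sets_eq_imp_space_eq[OF this(2)] show "space (P x) = counting_measures"
    by (simp add: space_counting_algebra)
qed

lemma palm_family_disintegration:
  assumes "palm_family M \<Phi> P" "\<Phi> \<in> M \<rightarrow>\<^sub>M counting_algebra" "B \<in> sets borel" "L \<in> sets counting_algebra"
  shows "(\<integral>\<^sup>+x\<in>B. emeasure (P x) L \<partial>moment_measure M \<Phi>) =
    (\<integral>\<^sup>+\<omega>. emeasure (\<Phi> \<omega>) B * indicator L (\<Phi> \<omega>) \<partial>M)"
  using assms by (simp add: palm_family_def emeasure_campbell_measure)

text \<open>Cover \<open>{(x, \<mu>). \<mu> {x} = 0}\<close> by the rectangles \<open>W \<times> {\<mu>. \<mu> W < 1}\<close> with \<open>W\<close> in a countable basis. By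
  integrality \<open>\<mu> W < 1\<close> forces \<open>\<mu> W = 0\<close>, so each of them has Campbell measure zero.\<close>

lemma palm_family_atom:
  fixes \<Phi> :: "'w \<Rightarrow> 'a::polish_space measure"
  assumes \<Phi> [measurable]: "\<Phi> \<in> M \<rightarrow>\<^sub>M counting_algebra" and P: "palm_family M \<Phi> P"
  shows "AE x in moment_measure M \<Phi>. AE \<mu> in P x. 1 \<le> emeasure \<mu> {x}"
proof -
  obtain \<B> :: "'a set set" where \<B>: "countable \<B>" "topological_basis \<B>"
    using ex_countable_basis by blast
  define L where "L W = {\<mu>\<in>counting_measures. emeasure \<mu> W < 1}" for W :: "'a set"
  \<comment> \<open>The exceptional null set depends on \<open>W\<close>; countability of the basis
    merges them into one that serves all \<open>W\<close>.\<close>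
  have "AE x in moment_measure M \<Phi>. \<forall>W\<in>\<B>. x \<in> W \<longrightarrow> emeasure (P x) (L W) = 0"
  proof (rule AE_ball_countable'[OF _ \<B>(1)])
    fix W assume "W \<in> \<B>"
    then have o: "open W" using \<B>(2) by (simp add: topological_basis_open)
    then have [measurable]: "W \<in> sets borel" by simp
    have "{\<mu>\<in>space counting_algebra. emeasure \<mu> W < 1} \<in> sets counting_algebra" by measurable
    then have LW: "L W \<in> sets counting_algebra" by (simp add: L_def space_counting_algebra)
    note [measurable] = palm_family_emeasure_measurable[OF P LW]
    have "(\<integral>\<^sup>+x\<in>W. emeasure (P x) (L W) \<partial>moment_measure M \<Phi>) = 0"
    proof (subst palm_family_disintegration[OF P \<Phi> _ LW])
      have "(\<integral>\<^sup>+\<omega>. emeasure (\<Phi> \<omega>) W * indicator (L W) (\<Phi> \<omega>) \<partial>M) = (\<integral>\<^sup>+\<omega>. 0 \<partial>M)"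
        using counting_measure_open_lt_1[OF _ o]
        by (intro nn_integral_cong) (auto simp: L_def indicator_def)
      then show "(\<integral>\<^sup>+\<omega>. emeasure (\<Phi> \<omega>) W * indicator (L W) (\<Phi> \<omega>) \<partial>M) = 0" by simp
    qed simp
    then have "AE x in moment_measure M \<Phi>. emeasure (P x) (L W) * indicator W x = 0"
      by (subst (asm) nn_integral_0_iff_AE) auto
    then show "AE x in moment_measure M \<Phi>. x \<in> W \<longrightarrow> emeasure (P x) (L W) = 0"
      by eventually_elim (auto simp: indicator_def)
  qed
  then show ?thesis
  proof eventually_elim
    case (elim x)
    \<comment> \<open>Avoiding \<open>L W\<close> for all basic \<open>W\<close> around
      \<open>x\<close> rules out small atoms: were \<open>\<mu> {x} < 1\<close>, some basic
      \<open>W\<close> containing \<open>x\<close> would have \<open>\<mu> W < 1\<close>.\<close>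
    have "AE \<mu> in P x. \<forall>W\<in>{W\<in>\<B>. x \<in> W}. \<mu> \<notin> L W"
    proof (rule AE_ball_countable')
      fix W assume W: "W \<in> {W\<in>\<B>. x \<in> W}"
      then have [measurable]: "W \<in> sets borel" using \<B>(2) by (simp add: topological_basis_open)
      have "{\<mu>\<in>space counting_algebra. emeasure \<mu> W < 1} \<in> sets counting_algebra" by measurable
      then have "L W \<in> null_sets (P x)"
        using elim W palm_family_kernel[OF P] by (auto simp: L_def space_counting_algebra null_sets_def)
      then show "AE \<mu> in P x. \<mu> \<notin> L W" by (rule AE_not_in)
    qed (use \<B>(1) in auto)
    then show ?case using AE_space
    proof eventually_elim
      case (elim \<mu>)
      then show ?case
        using ex_basis_emeasure_lt[OF _ \<B>(2), of \<mu> x 1] palm_family_kernel(3)[OF P, of x]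
        by (auto simp: L_def not_less[symmetric])
    qed
  qed
qed

section \<open>Uniqueness of Palm families\<close>

text \<open>A Dynkin system argument over the generator \<open>G\<close>. Intersecting with
  \<open>U\<close> and returning \<open>0\<close> where \<open>U\<close> has infinite mass keeps the
  subtraction in the complement step finite. The \<sigma>-algebra of \<open>N\<close> is left
  arbitrary so that \<open>N\<close> may later be generated by countably many sets.\<close>

lemma measurable_emeasure_Int_generator:
  fixes N :: "'b measure" and \<mu> :: "'b \<Rightarrow> 'a measure"
  assumes \<mu>: "\<And>y. y \<in> space N \<Longrightarrow> sets (\<mu> y) = sets S"
    and G: "Int_stable G" "G \<subseteq> Pow (space S)" "sets S = sigma_sets (space S) G"
    and U [measurable]: "(\<lambda>y. emeasure (\<mu> y) U) \<in> borel_measurable N" "U \<in> sets S"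
    and UG: "\<And>W. W \<in> G \<Longrightarrow> (\<lambda>y. emeasure (\<mu> y) (U \<inter> W)) \<in> borel_measurable N"
    and B: "B \<in> sets S"
  shows "(\<lambda>y. if emeasure (\<mu> y) U < \<infinity> then emeasure (\<mu> y) (U \<inter> B) else 0) \<in> borel_measurable N"
    (is "?f B \<in> _")
proof -
  have "B \<in> sigma_sets (space S) G" using B G by simp
  with G(1,2) show ?thesis
  proof (induction rule: sigma_sets_induct_disjoint)
    case (basic W)
    note [measurable] = UG[OF basic]
    show ?case by measurable
  next
    case empty
    show ?case unfolding Int_empty_right emeasure_empty by simp
  next
    case (compl C)
    have C: "C \<in> sets S" using compl G by simp
    have "?f (space S - C) y = (if emeasure (\<mu> y) U < \<infinity> then emeasure (\<mu> y) U - ?f C y else 0)"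
      if y: "y \<in> space N" for y
    proof (cases "emeasure (\<mu> y) U < \<infinity>")
      case True
      have "emeasure (\<mu> y) (U \<inter> C) \<le> emeasure (\<mu> y) U"
        using \<mu>[OF y] U by (intro emeasure_mono) auto
      with True have "emeasure (\<mu> y) (U \<inter> C) \<noteq> \<infinity>" by (auto simp: top_unique)
      moreover have "U \<inter> (space S - C) = U - U \<inter> C" using sets.sets_into_space[OF U(2)] by auto
      ultimately show ?thesis using True \<mu>[OF y] U(2) C by (simp add: emeasure_Diff)
    qed simp
    note eq = this
    have [measurable]: "?f C \<in> borel_measurable N" by (rule compl)
    have "(\<lambda>y. if emeasure (\<mu> y) U < \<infinity> then emeasure (\<mu> y) U - ?f C y else 0) \<in> borel_measurable N"
      by measurable
    then show ?case by (rule measurable_cong[THEN iffD2, rotated]) (rule eq)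
  next
    case (union C)
    have C: "C i \<in> sets S" for i using union G by auto
    have "?f (\<Union>i. C i) y = (\<Sum>i. ?f (C i) y)" if y: "y \<in> space N" for y
    proof (cases "emeasure (\<mu> y) U < \<infinity>")
      case True
      have "(\<Sum>i. emeasure (\<mu> y) (U \<inter> C i)) = emeasure (\<mu> y) (\<Union>i. U \<inter> C i)"
        using union(1) U(2) C \<mu>[OF y]
        by (intro suminf_emeasure) (auto simp: disjoint_family_on_def)
      then show ?thesis using True by simp
    qed simp
    note eq = this
    have "(\<lambda>y. \<Sum>i. ?f (C i) y) \<in> borel_measurable N"
      by (intro borel_measurable_suminf_order union)
    then show ?case by (rule measurable_cong[THEN iffD2, rotated]) (rule eq)
  qed
qed

text \<open>By local finiteness, finite unions of basic sets of finite mass exhaust the space. The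
  supremum runs over all finite \<open>S\<close>, so that its countable index set does not depend on
  \<mu>; the value \<open>0\<close> silences those \<open>S\<close> whose union has infinite
  mass.\<close>

lemma emeasure_counting_measure_SUP:
  fixes \<mu> :: "'a::polish_space measure" and U :: "nat \<Rightarrow> 'a set"
  assumes \<mu>: "\<mu> \<in> counting_measures" and U: "topological_basis (range U)" and B: "B \<in> sets borel"
  shows "emeasure \<mu> B = (SUP S\<in>{S. finite S}.
    if emeasure \<mu> (\<Union>n\<in>S. U n) < \<infinity> then emeasure \<mu> ((\<Union>n\<in>S. U n) \<inter> B) else 0)"
proof (rule antisym)
  have s: "sets \<mu> = sets borel" using \<mu> by (rule sets_counting_measures)
  have o: "U n \<in> sets borel" for n using U by (simp add: topological_basis_open)
  let ?g = "\<lambda>S. if emeasure \<mu> (\<Union>n\<in>S. U n) < \<infinity> then emeasure \<mu> ((\<Union>n\<in>S. U n) \<inter> B) else 0"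
  show "(SUP S\<in>{S. finite S}. ?g S) \<le> emeasure \<mu> B"
    using s o B by (intro SUP_least) (auto intro!: emeasure_mono)
  \<comment> \<open>This choice depends on \<mu> and is confined to the proof: among the first
    \<open>n\<close> basic sets it keeps those of finite mass, so the unions increase with
    \<open>n\<close>.\<close>
  define T where "T n = {m. m < n \<and> emeasure \<mu> (U m) < \<infinity>}" for n :: nat
  have fT: "finite (T n)" for n by (simp add: T_def)
  have cover: "(\<Union>n. (\<Union>m\<in>T n. U m) \<inter> B) = B"
  proof -
    have "\<exists>n. x \<in> U n \<and> emeasure \<mu> (U n) < \<infinity>" for x
    proof -
      obtain V where V: "open V" "x \<in> V" "emeasure \<mu> V < \<infinity>"
        using \<mu> unfolding counting_measures_def by blast
      obtain n where n: "x \<in> U n" "U n \<subseteq> V" using topological_basisE[OF U V(1,2)] by auto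
      have "emeasure \<mu> (U n) \<le> emeasure \<mu> V" using n V s by (intro emeasure_mono) auto
      with n V show ?thesis by (auto intro: le_less_trans)
    qed
    then show ?thesis by (fastforce simp: T_def)
  qed
  have "emeasure \<mu> (\<Union>n. (\<Union>m\<in>T n. U m) \<inter> B) = (SUP n. emeasure \<mu> ((\<Union>m\<in>T n. U m) \<inter> B))"
  proof (rule SUP_emeasure_incseq[symmetric])
    have "T m \<subseteq> T n" if "m \<le> n" for m n using that by (auto simp: T_def)
    then show "incseq (\<lambda>n. (\<Union>m\<in>T n. U m) \<inter> B)" unfolding incseq_def by blast
  qed (use s o B fT in auto)
  also have "\<dots> \<le> (SUP S\<in>{S. finite S}. ?g S)"
  proof (rule SUP_least)
    fix n
    have "emeasure \<mu> (\<Union>m\<in>T n. U m) \<le> (\<Sum>m\<in>T n. emeasure \<mu> (U m))"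
      using s o fT by (intro emeasure_subadditive_finite) auto
    also have "\<dots> < \<infinity>" using fT by (auto simp: T_def less_top[symmetric])
    finally have "emeasure \<mu> ((\<Union>m\<in>T n. U m) \<inter> B) = ?g (T n)" by simp
    also have "\<dots> \<le> (SUP S\<in>{S. finite S}. ?g S)" by (rule SUP_upper) (simp add: fT)
    finally show "emeasure \<mu> ((\<Union>m\<in>T n. U m) \<inter> B) \<le> (SUP S\<in>{S. finite S}. ?g S)" .
  qed
  finally show "emeasure \<mu> B \<le> (SUP S\<in>{S. finite S}. ?g S)" by (simp only: cover)
qed

text \<open>By local finiteness the values of \<open>\<mu>\<close> on all Borel sets are determined measurably by its values on
  finite unions of basic open sets, cut down by finite intersections.\<close>

lemma counting_algebra_countably_generated:
  "\<exists>H. countable H \<and> Int_stable H \<and> counting_measures \<in> H \<and> H \<subseteq> Pow counting_measures \<and>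
    sets (counting_algebra :: 'a::polish_space measure measure) = sigma_sets counting_measures H"
proof -
  obtain \<B> :: "'a set set" where \<B>: "countable \<B>" "topological_basis \<B>"
    using ex_countable_basis by blast
  have "\<B> \<noteq> {}" using topological_basisE[OF \<B>(2) open_UNIV UNIV_I] by blast
  define U where "U = from_nat_into \<B>"
  have rU: "range U = \<B>" unfolding U_def using \<open>\<B> \<noteq> {}\<close> \<B>(1) by (rule range_from_nat_into)
  have U: "topological_basis (range U)" using \<B> rU by simp
  have Ub: "U n \<in> sets borel" for n using U by (simp add: topological_basis_open)
  obtain E :: "ennreal set set" where E: "countable E" "topological_basis E"
    using ex_countable_basis by blast
  define \<I> where "\<I> = {S :: nat set. finite S}"
  have \<I>: "countable \<I>" unfolding \<I>_def by (rule countable_Collect_finite)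
  \<comment> \<open>The first component gives the localising union, the second a finite intersection
    from a generating \<pi>-system. An empty \<open>T\<close> gives the whole space, so
    \<open>W (S, {})\<close> is the plain union.\<close>
  define W where "W = (\<lambda>(S, T). (\<Union>n\<in>S. U n) \<inter> (\<Inter>n\<in>T. U n))"
  have Ib: "(\<Inter>n\<in>T. U n) \<in> sets borel" if "T \<in> \<I>" for T
    using that Ub by (cases "T = {}") (auto simp: \<I>_def intro!: sets.finite_INT)
  have Wb: "W i \<in> sets borel" if "i \<in> \<I> \<times> \<I>" for i
    using that Ub Ib by (auto simp: W_def \<I>_def)
  \<comment> \<open>Finite sets of constraints make the family closed under intersection, and target
    sets from the countable basis \<open>E\<close> keep it countable. The empty set of constraints
    gives all counting measures.\<close>
  define \<F> where "\<F> = {F. finite F \<and> F \<subseteq> (\<I> \<times> \<I>) \<times> E}"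
  define h where "h F = {\<mu> \<in> counting_measures. \<forall>(i, b)\<in>F. emeasure \<mu> (W i) \<in> b}" for F
  define H where "H = h ` \<F>"
  have cH: "countable H"
    unfolding H_def \<F>_def using \<I> E by (intro countable_image countable_Collect_finite_subset) auto
  have iH: "Int_stable H"
  proof (rule Int_stableI)
    fix a b assume "a \<in> H" "b \<in> H"
    then obtain F F' where F: "F \<in> \<F>" "F' \<in> \<F>" "a = h F" "b = h F'" by (auto simp: H_def)
    then have "a \<inter> b = h (F \<union> F')" by (auto simp: h_def)
    moreover have "F \<union> F' \<in> \<F>" using F by (auto simp: \<F>_def)
    ultimately show "a \<inter> b \<in> H" by (auto simp: H_def)
  qed
  have top: "counting_measures \<in> H"
    unfolding H_def by (rule image_eqI[of _ _ "{}"]) (auto simp: h_def \<F>_def)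
  have pow: "H \<subseteq> Pow counting_measures" by (auto simp: H_def h_def)
  have "sigma_sets counting_measures H \<subseteq> sets counting_algebra"
  proof -
    have "h F \<in> sets counting_algebra" if F: "F \<in> \<F>" for F
    proof -
      have "{\<mu> \<in> space counting_algebra. emeasure \<mu> (W (fst z)) \<in> snd z} \<in> sets counting_algebra"
        if "z \<in> F" for z
      proof -
        have [measurable]: "W (fst z) \<in> sets borel" "snd z \<in> sets borel"
          using that F Wb E(2) by (auto simp: \<F>_def topological_basis_open)
        show ?thesis by measurable
      qed
      moreover have "finite F" using F by (simp add: \<F>_def)
      ultimately have "{\<mu> \<in> space counting_algebra. \<forall>z\<in>F. emeasure \<mu> (W (fst z)) \<in> snd z} \<in> sets counting_algebra"
        by (intro sets.sets_Collect_finite_All) auto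
      then show ?thesis by (simp add: h_def space_counting_algebra split_beta)
    qed
    then show ?thesis
      using sets.sigma_sets_subset[of H "counting_algebra"] by (auto simp: H_def space_counting_algebra)
  qed
  moreover have "sets counting_algebra \<subseteq> sigma_sets counting_measures H"
  proof -
    \<comment> \<open>The inclusion amounts to measurability of the identity from \<open>N\<close>
      to \<open>counting_algebra\<close>, that is, of all evaluations at Borel sets when only
      \<open>H\<close> generates the measurable sets.\<close>
    define N where "N = sigma counting_measures H"
    have N: "space N = counting_measures" "sets N = sigma_sets counting_measures H"
      using pow by (auto simp: N_def)
    have Wm: "(\<lambda>\<mu>. emeasure \<mu> (W i)) \<in> borel_measurable N" if i: "i \<in> \<I> \<times> \<I>" for i
      unfolding borel_eq_countable_basis[OF E]
    proof (rule measurable_measure_of)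
      fix b assume b: "b \<in> E"
      have "(\<lambda>\<mu>. emeasure \<mu> (W i)) -` b \<inter> space N = h {(i, b)}" by (auto simp: N h_def)
      also have "\<dots> \<in> H" using i b by (auto simp: H_def \<F>_def)
      finally show "(\<lambda>\<mu>. emeasure \<mu> (W i)) -` b \<inter> space N \<in> sets N" by (simp add: N)
    qed auto
    let ?G = "(\<lambda>T. \<Inter>n\<in>T. U n) ` \<I>"
    have G1: "Int_stable ?G"
    proof (rule Int_stableI_image)
      fix T T' assume "T \<in> \<I>" "T' \<in> \<I>"
      then show "\<exists>T''\<in>\<I>. (\<Inter>n\<in>T. U n) \<inter> (\<Inter>n\<in>T'. U n) = (\<Inter>n\<in>T''. U n)"
        by (intro bexI[of _ "T \<union> T'"]) (auto simp: \<I>_def)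
    qed
    have G2: "sets (borel :: 'a measure) = sigma_sets UNIV ?G"
    proof
      have "\<B> \<subseteq> ?G" unfolding rU[symmetric]
        by (auto simp: \<I>_def intro!: image_eqI[of _ _ "{_}"])
      then show "sets (borel :: 'a measure) \<subseteq> sigma_sets UNIV ?G"
        unfolding borel_eq_countable_basis[OF \<B>] by (simp add: sigma_sets_mono')
      have "?G \<subseteq> sets borel" using Ib by auto
      then show "sigma_sets UNIV ?G \<subseteq> sets borel"
        using sets.sigma_sets_subset[of ?G "borel :: 'a measure"] by simp
    qed
    have f: "(\<lambda>\<mu>. if emeasure \<mu> (\<Union>n\<in>S. U n) < \<infinity> then emeasure \<mu> ((\<Union>n\<in>S. U n) \<inter> B) else 0)
        \<in> borel_measurable N" if S: "S \<in> \<I>" and B: "B \<in> sets borel" for S B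
    proof (rule measurable_emeasure_Int_generator[where G = ?G and S = borel])
      show "(\<lambda>\<mu>. emeasure \<mu> (\<Union>n\<in>S. U n)) \<in> borel_measurable N"
        using Wm[of "(S, {})"] S by (simp add: W_def \<I>_def)
      show "(\<lambda>\<mu>. emeasure \<mu> ((\<Union>n\<in>S. U n) \<inter> V)) \<in> borel_measurable N" if "V \<in> ?G" for V
        using that Wm[of "(S, _)"] S by (auto simp: W_def)
      show "(\<Union>n\<in>S. U n) \<in> sets borel" using Ub S by auto
    qed (use G1 G2 B in \<open>auto simp: N sets_counting_measures\<close>)
    have "(\<lambda>\<mu>. \<mu>) \<in> N \<rightarrow>\<^sub>M counting_algebra"
    proof (rule measurable_counting_algebra)
      fix B :: "'a set" assume B: "B \<in> sets borel"
      have "(\<lambda>\<mu>. SUP S\<in>\<I>. if emeasure \<mu> (\<Union>n\<in>S. U n) < \<infinity> then emeasure \<mu> ((\<Union>n\<in>S. U n) \<inter> B) else 0)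
        \<in> borel_measurable N"
        using \<I> B by (intro borel_measurable_SUP f)
      then show "(\<lambda>\<mu>. emeasure \<mu> B) \<in> borel_measurable N"
        by (rule measurable_cong[THEN iffD2, rotated])
          (use emeasure_counting_measure_SUP[OF _ U B] in \<open>simp add: N \<I>_def\<close>)
    qed (simp add: N)
    from measurable_sets[OF this] show ?thesis
      using sets.sets_into_space[of _ "counting_algebra :: 'a measure measure"]
      by (auto simp: N space_counting_algebra Int_absorb2)
  qed
  ultimately show ?thesis using cH iH top pow by blast
qed

text \<open>The weight \<open>q\<close> localises the statement, so that only the moment measures of the summands
  need to be \<open>\<sigma>\<close>-finite.\<close>

lemma palm_family_unique:
  fixes \<Phi> :: "'w \<Rightarrow> 'a::polish_space measure"
  assumes \<Phi>: "\<Phi> \<in> M \<rightarrow>\<^sub>M counting_algebra"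
    and P: "palm_family M \<Phi> P" and P': "palm_family M \<Phi> P'"
    and q [measurable]: "q \<in> borel_measurable borel"
    and fin: "sigma_finite_measure (density (moment_measure M \<Phi>) q)"
  shows "AE x in density (moment_measure M \<Phi>) q. P x = P' x"
proof -
  obtain H where H: "countable H" "Int_stable H" "counting_measures \<in> H" "H \<subseteq> Pow counting_measures"
    "sets (counting_algebra :: 'a measure measure) = sigma_sets counting_measures H"
    using counting_algebra_countably_generated by blast
  interpret D: sigma_finite_measure "density (moment_measure M \<Phi>) q" by (fact fin)
  \<comment> \<open>\<open>H\<close> is a countable \<pi>-system containing the whole space: one
    null set serves all of its members, and agreement on them determines a probability
    measure.\<close>
  have "AE x in density (moment_measure M \<Phi>) q. \<forall>L\<in>H. emeasure (P x) L = emeasure (P' x) L"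
  proof (rule AE_ball_countable'[OF _ H(1)])
    fix L assume "L \<in> H"
    then have L: "L \<in> sets counting_algebra" using H by auto
    note [measurable] = palm_family_emeasure_measurable[OF P L] palm_family_emeasure_measurable[OF P' L]
    \<comment> \<open>Both densities assign to each Borel set \<open>B\<close> the Campbell mass of
      \<open>B \<times> L\<close>.\<close>
    have "density (moment_measure M \<Phi>) (\<lambda>x. emeasure (P x) L) =
        density (moment_measure M \<Phi>) (\<lambda>x. emeasure (P' x) L)"
      by (rule measure_eqI)
        (simp_all add: emeasure_density palm_family_disintegration[OF P \<Phi> _ L]
          palm_family_disintegration[OF P' \<Phi> _ L])
    then have "density (density (moment_measure M \<Phi>) (\<lambda>x. emeasure (P x) L)) q =
        density (density (moment_measure M \<Phi>) (\<lambda>x. emeasure (P' x) L)) q"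
      by simp
    \<comment> \<open>Interchanging the two densities moves \<open>q\<close> into the base measure,
      which is assumed \<sigma>-finite, so that uniqueness of densities applies.\<close>
    then have "density (density (moment_measure M \<Phi>) q) (\<lambda>x. emeasure (P x) L) =
        density (density (moment_measure M \<Phi>) q) (\<lambda>x. emeasure (P' x) L)"
      by (simp add: density_density_eq mult.commute)
    then show "AE x in density (moment_measure M \<Phi>) q. emeasure (P x) L = emeasure (P' x) L"
      by (intro D.density_unique) auto
  qed
  then show ?thesis
  proof eventually_elim
    case (elim x)
    interpret prob_space "P x" by (rule palm_family_kernel[OF P])
    show ?case
      using H elim palm_family_kernel[OF P, of x] palm_family_kernel[OF P', of x] emeasure_finite
      by (intro measure_eqI_generator_eq_countable[where E = H and \<Omega> = counting_measures
            and A = "{counting_measures}"]) auto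
  qed
qed

section \<open>Superposition and removal of a point\<close>

lemma measurable_superposition:
  fixes f :: "'i \<Rightarrow> 'b \<Rightarrow> 'a::polish_space measure"
  assumes f: "\<And>i. i \<in> I \<Longrightarrow> f i \<in> N \<rightarrow>\<^sub>M counting_algebra"
  shows "(\<lambda>y. superposition I (\<lambda>i. f i y)) \<in> N \<rightarrow>\<^sub>M counting_algebra"
proof (rule measurable_counting_algebra)
  show "superposition I (\<lambda>i. f i y) \<in> counting_measures" if "y \<in> space N" for y
    using measurable_space[OF f that]
    by (intro superposition_in_counting_measures) (simp add: space_counting_algebra)
  fix B :: "'a set" assume B [measurable]: "B \<in> sets borel"
  have "(\<lambda>y. \<Sum>i\<in>I. emeasure (f i y) B) \<in> borel_measurable N"
    by (intro borel_measurable_sum measurable_compose[OF f measurable_emeasure_counting_algebra] B)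
  then show "(\<lambda>y. emeasure (superposition I (\<lambda>i. f i y)) B) \<in> borel_measurable N"
    by (rule measurable_cong[THEN iffD2, rotated])
      (use B in \<open>simp add: emeasure_superposition sets_point_process[OF f]\<close>)
qed

lemma measurable_superposition_upd:
  assumes \<Phi>: "\<And>i. i \<in> I \<Longrightarrow> i \<noteq> j \<Longrightarrow> \<Phi> i \<in> N \<rightarrow>\<^sub>M counting_algebra"
  shows "(\<lambda>(\<mu>, \<omega>). superposition I ((\<lambda>i. \<Phi> i \<omega>)(j := \<mu>))) \<in>
    counting_algebra \<Otimes>\<^sub>M N \<rightarrow>\<^sub>M counting_algebra"
proof -
  have "(\<lambda>z. superposition I (\<lambda>i. if i = j then fst z else \<Phi> i (snd z))) \<in>
    counting_algebra \<Otimes>\<^sub>M N \<rightarrow>\<^sub>M counting_algebra"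
  proof (rule measurable_superposition)
    show "(\<lambda>z. if i = j then fst z else \<Phi> i (snd z)) \<in> counting_algebra \<Otimes>\<^sub>M N \<rightarrow>\<^sub>M counting_algebra"
      if "i \<in> I" for i
      using that by (cases "i = j") (auto intro: measurable_compose[OF measurable_snd \<Phi>])
  qed
  then show ?thesis by (simp add: fun_upd_def split_beta')
qed

lemma measurable_remove_point:
  "remove_point x \<in> counting_algebra \<rightarrow>\<^sub>M counting_algebra"
proof (rule measurable_counting_algebra)
  fix \<mu> :: "'a measure" assume "\<mu> \<in> space counting_algebra"
  then have \<mu>: "\<mu> \<in> counting_measures" by (simp add: space_counting_algebra)
  show "remove_point x \<mu> \<in> counting_measures"
  proof (cases "1 \<le> emeasure \<mu> {x}")
    case True
    have s: "sets \<mu> = sets borel" using \<mu> by (rule sets_counting_measures)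
    note e = emeasure_remove_point[OF s True]
    have "\<exists>U. open U \<and> y \<in> U \<and> emeasure (remove_point x \<mu>) U < \<infinity>" for y
    proof -
      obtain U where U: "open U" "y \<in> U" "emeasure \<mu> U < \<infinity>"
        using \<mu> unfolding counting_measures_def by blast
      have "emeasure (remove_point x \<mu>) U \<le> emeasure \<mu> U"
        using U by (simp add: e diff_le_self_ennreal)
      with U show ?thesis by (auto intro: le_less_trans)
    qed
    moreover have "emeasure (remove_point x \<mu>) B \<in> \<nat>"
      if B: "B \<in> sets borel" "compact (closure B)" for B
    proof -
      have "emeasure \<mu> B \<in> \<nat>" using \<mu> B by (auto simp: counting_measures_def)
      then obtain n where n: "emeasure \<mu> B = of_nat n" by (elim Nats_cases)
      \<comment> \<open>Both subtractions truncate at \<open>0\<close>, so the case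
        \<open>n = 0\<close> is covered too.\<close>
      have "(of_nat n :: ennreal) - 1 = of_nat (n - 1)"
        by (cases n) (simp_all add: ennreal_of_nat_eq_real_of_nat ennreal_minus flip: ennreal_1)
      then show ?thesis using B by (simp add: e n indicator_def)
    qed
    moreover have "sets (remove_point x \<mu>) = sets borel"
      using s True by (simp add: remove_point_def)
    ultimately show ?thesis by (simp add: counting_measures_def)
  qed (use \<mu> in \<open>simp add: remove_point_def\<close>)
next
  fix B :: "'a set" assume [measurable]: "B \<in> sets borel"
  have "(\<lambda>\<mu>. if 1 \<le> emeasure \<mu> {x} then emeasure \<mu> B - indicator B x else emeasure \<mu> B)
    \<in> borel_measurable counting_algebra"
    by measurable
  then show "(\<lambda>\<mu>. emeasure (remove_point x \<mu>) B) \<in> borel_measurable counting_algebra"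
    by (rule measurable_cong[THEN iffD2, rotated])
      (auto simp: emeasure_remove_point space_counting_algebra sets_counting_measures,
       simp add: remove_point_def)
qed

text \<open>An atom of mass at least \<open>1\<close> in the \<open>j\<close>th summand is enough to
  charge the removed point to that summand alone. It also gives the sum such an atom, so both
  removals are proper subtractions and not the default case of \<open>remove_point\<close>.\<close>

lemma remove_point_superposition:
  assumes I: "finite I" "j \<in> I" and \<nu>: "\<And>i. i \<in> I \<Longrightarrow> sets (\<nu> i) = sets borel"
    and x: "1 \<le> emeasure (\<nu> j) {x}"
  shows "remove_point x (superposition I \<nu>) = superposition I (\<nu>(j := remove_point x (\<nu> j)))"
proof (rule measure_eqI)
  have s: "emeasure (superposition I \<nu>) B = emeasure (\<nu> j) B + (\<Sum>i\<in>I - {j}. emeasure (\<nu> i) B)"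
    if "B \<in> sets borel" for B
    using that I \<nu> by (simp add: emeasure_superposition sum.remove)
  have x': "1 \<le> emeasure (superposition I \<nu>) {x}"
    using x by (simp add: s add_increasing2)
  show sets: "sets (remove_point x (superposition I \<nu>)) = sets (superposition I (\<nu>(j := remove_point x (\<nu> j))))"
    using x' by (simp add: remove_point_def)
  have r: "sets (remove_point x (\<nu> j)) = sets borel"
    using x I \<nu> by (simp add: remove_point_def)
  fix B assume "B \<in> sets (remove_point x (superposition I \<nu>))"
  then have B: "B \<in> sets borel" using sets by simp
  \<comment> \<open>Subtraction of \<open>ennreal\<close> values truncates; this bound justifies
    \<open>a + (b - c) = (a + b) - c\<close> when the point is taken from the \<open>j\<close>th
    term.\<close>
  have le: "indicator B x \<le> emeasure (\<nu> j) B"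
  proof (cases "x \<in> B")
    case True
    then have "emeasure (\<nu> j) {x} \<le> emeasure (\<nu> j) B" using B I \<nu> by (intro emeasure_mono) auto
    with x True show ?thesis by (auto intro: order_trans)
  qed simp
  have "emeasure (superposition I (\<nu>(j := remove_point x (\<nu> j)))) B =
      emeasure (remove_point x (\<nu> j)) B + (\<Sum>i\<in>I - {j}. emeasure (\<nu> i) B)"
    using B I \<nu> r by (subst emeasure_superposition) (auto simp: sum.remove)
  also have "\<dots> = (\<Sum>i\<in>I - {j}. emeasure (\<nu> i) B) + (emeasure (\<nu> j) B - indicator B x)"
    using x B I \<nu> by (simp add: emeasure_remove_point add.commute)
  also have "\<dots> = emeasure (superposition I \<nu>) B - indicator B x"
    using le by (simp add: s[OF B] add_diff_eq_ennreal add.commute[of "emeasure (\<nu> j) B"])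
  finally show "emeasure (remove_point x (superposition I \<nu>)) B =
      emeasure (superposition I (\<nu>(j := remove_point x (\<nu> j)))) B"
    using x' B by (simp add: emeasure_remove_point)
qed

lemma superposition_cong: "(\<And>i. i \<in> I \<Longrightarrow> \<mu> i = \<nu> i) \<Longrightarrow> superposition I \<mu> = superposition I \<nu>"
  by (simp add: superposition_def)

section \<open>Palm distributions of a superposition\<close>

locale independent_point_processes = prob_space M
  for M :: "'w measure" +
  fixes I :: "'i set" and \<Phi> :: "'i \<Rightarrow> 'w \<Rightarrow> 'a::polish_space measure"
    and P :: "'i \<Rightarrow> 'a \<Rightarrow> 'a measure measure"
  assumes finite_index: "finite I"
    and point_process: "i \<in> I \<Longrightarrow> \<Phi> i \<in> M \<rightarrow>\<^sub>M counting_algebra"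
    and indep: "indep_vars (\<lambda>_. counting_algebra) \<Phi> I"
    and sigma_finite_moment: "i \<in> I \<Longrightarrow> sigma_finite_measure (moment_measure M (\<Phi> i))"
    and palm: "i \<in> I \<Longrightarrow> palm_family M (\<Phi> i) (P i)"
begin

abbreviation sum_process :: "'w \<Rightarrow> 'a measure" where
  "sum_process \<omega> \<equiv> superposition I (\<lambda>i. \<Phi> i \<omega>)"

text \<open>By independence, \<open>resample j\<close> may draw the summands other than \<open>\<Phi> j\<close> from a second, independent
  sample point \<open>\<omega>\<close>.\<close>

abbreviation resample :: "'i \<Rightarrow> 'a measure \<times> 'w \<Rightarrow> 'a measure" where
  "resample j \<equiv> \<lambda>(\<mu>, \<omega>). superposition I ((\<lambda>i. \<Phi> i \<omega>)(j := \<mu>))"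

text \<open>The product measure makes the Palm version independent of the other summands, which keep
  \<open>M\<close> as their sample space.\<close>

abbreviation component_law :: "'i \<Rightarrow> 'a \<Rightarrow> 'a measure measure" where
  "component_law j x \<equiv> distr (P j x \<Otimes>\<^sub>M M) counting_algebra (resample j)"

lemma sum_process_measurable: "sum_process \<in> M \<rightarrow>\<^sub>M counting_algebra"
  by (intro measurable_superposition point_process)

lemma resample_measurable: "resample j \<in> counting_algebra \<Otimes>\<^sub>M M \<rightarrow>\<^sub>M counting_algebra"
  by (intro measurable_superposition_upd point_process)

text \<open>Independence of \<open>\<Phi> j\<close> from the family of the other summands factorises
  their joint law, so Tonelli allows two separate sample points. The integral over
  \<open>\<Phi> j\<close> is the inner one, so that the others are frozen there.\<close>

lemma nn_integral_resample:
  assumes j: "j \<in> I" and g [measurable]: "g \<in> borel_measurable (counting_algebra \<Otimes>\<^sub>M counting_algebra)"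
  shows "(\<integral>\<^sup>+\<omega>. g (\<Phi> j \<omega>, sum_process \<omega>) \<partial>M) = (\<integral>\<^sup>+\<omega>'. \<integral>\<^sup>+\<omega>. g (\<Phi> j \<omega>, resample j (\<Phi> j \<omega>, \<omega>')) \<partial>M \<partial>M)"
proof -
  let ?N = "\<lambda>J. PiM J (\<lambda>_. counting_algebra :: 'a measure measure)"
  let ?X = "\<lambda>J \<omega>. restrict (\<lambda>i. \<Phi> i \<omega>) J"
  let ?J = "I - {j}"
  have "indep_var (?N {j}) (?X {j}) (?N ?J) (?X ?J)"
    using j by (intro indep_var_restrict[OF indep]) auto
  then have X [measurable]: "?X {j} \<in> M \<rightarrow>\<^sub>M ?N {j}" "?X ?J \<in> M \<rightarrow>\<^sub>M ?N ?J"
    and joint: "distr M (?N {j}) (?X {j}) \<Otimes>\<^sub>M distr M (?N ?J) (?X ?J) =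
      distr M (?N {j} \<Otimes>\<^sub>M ?N ?J) (\<lambda>\<omega>. (?X {j} \<omega>, ?X ?J \<omega>))"
    by (auto simp: indep_var_distribution_eq)
  let ?h = "\<lambda>z. g (fst z j, superposition I (\<lambda>i. if i = j then fst z j else snd z i))"
  have fj [measurable]: "(\<lambda>z. fst z j) \<in> ?N {j} \<Otimes>\<^sub>M ?N ?J \<rightarrow>\<^sub>M counting_algebra"
    by measurable
  have "(\<lambda>z. superposition I (\<lambda>i. if i = j then fst z j else snd z i))
      \<in> ?N {j} \<Otimes>\<^sub>M ?N ?J \<rightarrow>\<^sub>M counting_algebra"
  proof (rule measurable_superposition)
    fix i assume i: "i \<in> I"
    show "(\<lambda>z. if i = j then fst z j else snd z i) \<in> ?N {j} \<Otimes>\<^sub>M ?N ?J \<rightarrow>\<^sub>M counting_algebra"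
      using fj i by (cases "i = j") (auto intro!: measurable_compose[OF measurable_snd measurable_component_singleton])
  qed
  then have h [measurable]: "?h \<in> borel_measurable (?N {j} \<Otimes>\<^sub>M ?N ?J)"
    by measurable
  have eq: "superposition I (\<lambda>i. if i = j then ?X {j} \<omega> j else ?X ?J \<omega>' i) = resample j (\<Phi> j \<omega>, \<omega>')" for \<omega> \<omega>'
    by (auto intro!: superposition_cong)
  \<comment> \<open>Overwriting summand \<open>j\<close> with its own value changes nothing, so
    equal sample points recover the original sum.\<close>
  have eq': "resample j (\<Phi> j \<omega>, \<omega>) = sum_process \<omega>" for \<omega>
    by (auto intro!: superposition_cong)
  interpret DX: prob_space "distr M (?N {j}) (?X {j})" by (rule prob_space_distr) measurable
  interpret DY: prob_space "distr M (?N ?J) (?X ?J)" by (rule prob_space_distr) measurable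
  interpret pair_sigma_finite "distr M (?N {j}) (?X {j})" "distr M (?N ?J) (?X ?J)" ..
  have "(\<integral>\<^sup>+\<omega>. g (\<Phi> j \<omega>, sum_process \<omega>) \<partial>M) = (\<integral>\<^sup>+\<omega>. ?h (?X {j} \<omega>, ?X ?J \<omega>) \<partial>M)"
    by (simp only: fst_conv snd_conv eq eq') simp
  also have "\<dots> = (\<integral>\<^sup>+z. ?h z \<partial>(distr M (?N {j}) (?X {j}) \<Otimes>\<^sub>M distr M (?N ?J) (?X ?J)))"
    unfolding joint by (rule nn_integral_distr[symmetric, OF measurable_Pair[OF X]]) (simp add: h)
  also have "\<dots> = (\<integral>\<^sup>+y. \<integral>\<^sup>+x. ?h (x, y) \<partial>distr M (?N {j}) (?X {j}) \<partial>distr M (?N ?J) (?X ?J))"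
    by (rule nn_integral_snd[symmetric]) (use h in \<open>simp cong: measurable_cong_sets sets_pair_measure_cong\<close>)
  also have "\<dots> = (\<integral>\<^sup>+y. \<integral>\<^sup>+\<omega>. ?h (?X {j} \<omega>, y) \<partial>M \<partial>distr M (?N ?J) (?X ?J))"
    by (intro nn_integral_cong nn_integral_distr) measurable
  also have "\<dots> = (\<integral>\<^sup>+\<omega>'. \<integral>\<^sup>+\<omega>. ?h (?X {j} \<omega>, ?X ?J \<omega>') \<partial>M \<partial>M)"
    by (rule nn_integral_distr) measurable
  also have "\<dots> = (\<integral>\<^sup>+\<omega>'. \<integral>\<^sup>+\<omega>. g (\<Phi> j \<omega>, resample j (\<Phi> j \<omega>, \<omega>')) \<partial>M \<partial>M)"
    by (simp only: fst_conv snd_conv eq) simp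
  finally show ?thesis .
qed

lemma component_law_kernel:
  assumes j: "j \<in> I"
  shows "component_law j \<in> borel \<rightarrow>\<^sub>M prob_algebra counting_algebra"
proof -
  have [measurable]: "P j \<in> borel \<rightarrow>\<^sub>M prob_algebra counting_algebra"
    using palm_family_measurable[OF palm[OF j]] .
  have "M \<in> space (prob_algebra M)" by (simp add: space_prob_algebra prob_space_axioms)
  then have "(\<lambda>x. P j x \<Otimes>\<^sub>M M) \<in> borel \<rightarrow>\<^sub>M prob_algebra (counting_algebra \<Otimes>\<^sub>M M)"
    by measurable
  then show ?thesis
    by (rule measurable_compose) (rule measurable_distr_prob_space[OF resample_measurable])
qed

lemma emeasure_component_law:
  assumes j: "j \<in> I" and L [measurable]: "L \<in> sets counting_algebra"
  shows "emeasure (component_law j x) L = (\<integral>\<^sup>+\<omega>. \<integral>\<^sup>+\<mu>. indicator L (resample j (\<mu>, \<omega>)) \<partial>P j x \<partial>M)"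
proof -
  interpret Px: prob_space "P j x" by (rule palm_family_kernel[OF palm[OF j]])
  interpret pair_sigma_finite "P j x" M ..
  note [measurable_cong] = palm_family_kernel(2)[OF palm[OF j]]
  have T [measurable]: "resample j \<in> P j x \<Otimes>\<^sub>M M \<rightarrow>\<^sub>M counting_algebra"
    using resample_measurable[of j] by (simp cong: measurable_cong_sets sets_pair_measure_cong)
  have "emeasure (component_law j x) L = (\<integral>\<^sup>+\<nu>. indicator L \<nu> \<partial>component_law j x)"
    by simp
  also have "\<dots> = (\<integral>\<^sup>+z. indicator L (resample j z) \<partial>(P j x \<Otimes>\<^sub>M M))"
    by (rule nn_integral_distr[OF T]) simp
  also have "\<dots> = (\<integral>\<^sup>+\<omega>. \<integral>\<^sup>+\<mu>. indicator L (resample j (\<mu>, \<omega>)) \<partial>P j x \<partial>M)"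
    by (rule nn_integral_snd[symmetric]) (rule measurable_compose[OF T], simp)
  finally show ?thesis .
qed

lemma component_disintegration:
  assumes j: "j \<in> I" and B [measurable]: "B \<in> sets borel" and L [measurable]: "L \<in> sets counting_algebra"
  shows "(\<integral>\<^sup>+\<omega>. emeasure (\<Phi> j \<omega>) B * indicator L (sum_process \<omega>) \<partial>M) =
    (\<integral>\<^sup>+x\<in>B. emeasure (component_law j x) L \<partial>moment_measure M (\<Phi> j))"
proof -
  let ?MM = "moment_measure M (\<Phi> j)"
  interpret MM: sigma_finite_measure ?MM by (rule sigma_finite_moment[OF j])
  interpret pair_sigma_finite ?MM M ..
  note [measurable] = resample_measurable[of j]
  have P [measurable]: "P j \<in> borel \<rightarrow>\<^sub>M subprob_algebra counting_algebra"
    using palm_family_measurable[OF palm[OF j]] by (rule measurable_prob_algebraD)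
  define L' where "L' \<omega> = {\<mu>\<in>counting_measures. resample j (\<mu>, \<omega>) \<in> L}" for \<omega>
  have L': "L' \<omega> \<in> sets counting_algebra" if [simp]: "\<omega> \<in> space M" for \<omega>
  proof -
    have "L' \<omega> = (\<lambda>\<mu>. resample j (\<mu>, \<omega>)) -` L \<inter> space counting_algebra"
      by (auto simp: L'_def space_counting_algebra)
    also have "\<dots> \<in> sets counting_algebra"
      by (rule measurable_sets[OF measurable_compose[OF measurable_Pair2' resample_measurable] L]) simp
    finally show ?thesis .
  qed
  have PL': "emeasure (P j x) (L' \<omega>) = (\<integral>\<^sup>+\<mu>. indicator L (resample j (\<mu>, \<omega>)) \<partial>P j x)"
    if "\<omega> \<in> space M" for x \<omega>
  proof -
    have "emeasure (P j x) (L' \<omega>) = (\<integral>\<^sup>+\<mu>. indicator (L' \<omega>) \<mu> \<partial>P j x)"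
      using L'[OF that] palm_family_kernel(2)[OF palm[OF j]] by (intro nn_integral_indicator[symmetric]) simp
    also have "\<dots> = (\<integral>\<^sup>+\<mu>. indicator L (resample j (\<mu>, \<omega>)) \<partial>P j x)"
      using palm_family_kernel(3)[OF palm[OF j]]
      by (intro nn_integral_cong) (simp add: L'_def indicator_def)
    finally show ?thesis .
  qed
  \<comment> \<open>Tonelli needs joint measurability in \<open>(x, \<omega>)\<close>. The kernel
    integral from \<open>PL'\<close> provides it, since \<omega> enters only through the
    integrand.\<close>
  have m: "(\<lambda>(x, \<omega>). (\<integral>\<^sup>+\<mu>. indicator L (resample j (\<mu>, \<omega>)) \<partial>P j x) * indicator B x)
    \<in> borel_measurable (?MM \<Otimes>\<^sub>M M)"
  proof -
    have "(\<lambda>z. \<integral>\<^sup>+\<mu>. indicator L (resample j (\<mu>, snd z)) \<partial>P j (fst z)) \<in> borel_measurable (?MM \<Otimes>\<^sub>M M)"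
    proof (rule nn_integral_measurable_subprob_algebra2)
      have "(\<lambda>y. (snd y, snd (fst y))) \<in> (?MM \<Otimes>\<^sub>M M) \<Otimes>\<^sub>M counting_algebra \<rightarrow>\<^sub>M counting_algebra \<Otimes>\<^sub>M M"
        by measurable
      from measurable_compose[OF measurable_compose[OF this resample_measurable[of j]] borel_measurable_indicator[OF L]]
      show "(\<lambda>(z, \<mu>). indicator L (resample j (\<mu>, snd z))) \<in> borel_measurable ((?MM \<Otimes>\<^sub>M M) \<Otimes>\<^sub>M counting_algebra)"
        by (simp add: split_beta')
    qed measurable
    then show ?thesis by (simp add: split_beta')
  qed
  have "(\<integral>\<^sup>+\<omega>. emeasure (\<Phi> j \<omega>) B * indicator L (sum_process \<omega>) \<partial>M) =
      (\<integral>\<^sup>+\<omega>'. \<integral>\<^sup>+\<omega>. emeasure (\<Phi> j \<omega>) B * indicator L (resample j (\<Phi> j \<omega>, \<omega>')) \<partial>M \<partial>M)"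
    using nn_integral_resample[OF j, of "\<lambda>(\<mu>, \<nu>). emeasure \<mu> B * indicator L \<nu>"] by simp
  also have "\<dots> = (\<integral>\<^sup>+\<omega>'. \<integral>\<^sup>+\<omega>. emeasure (\<Phi> j \<omega>) B * indicator (L' \<omega>') (\<Phi> j \<omega>) \<partial>M \<partial>M)"
    using measurable_space[OF point_process[OF j]]
    by (intro nn_integral_cong) (simp add: L'_def indicator_def space_counting_algebra)
  also have "\<dots> = (\<integral>\<^sup>+\<omega>. (\<integral>\<^sup>+x\<in>B. emeasure (P j x) (L' \<omega>) \<partial>?MM) \<partial>M)"
    by (intro nn_integral_cong palm_family_disintegration[symmetric] palm point_process j B L')
  also have "\<dots> = (\<integral>\<^sup>+\<omega>. \<integral>\<^sup>+x. (\<integral>\<^sup>+\<mu>. indicator L (resample j (\<mu>, \<omega>)) \<partial>P j x) * indicator B x \<partial>?MM \<partial>M)"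
    by (intro nn_integral_cong) (simp add: PL')
  also have "\<dots> = (\<integral>\<^sup>+x. \<integral>\<^sup>+\<omega>. (\<integral>\<^sup>+\<mu>. indicator L (resample j (\<mu>, \<omega>)) \<partial>P j x) * indicator B x \<partial>M \<partial>?MM)"
    by (rule Fubini'[OF m])
  also have "\<dots> = (\<integral>\<^sup>+x\<in>B. emeasure (component_law j x) L \<partial>?MM)"
    unfolding emeasure_component_law[OF j L]
    by (intro nn_integral_cong) (simp add: indicator_def)
  finally show ?thesis .
qed

end

section \<open>The mixture as a Palm family of the sum\<close>

locale superposition_palm = independent_point_processes M I \<Phi> P
  for M :: "'w measure" and I :: "'i set" and \<Phi> :: "'i \<Rightarrow> 'w \<Rightarrow> 'a::polish_space measure"
    and P :: "'i \<Rightarrow> 'a \<Rightarrow> 'a measure measure" +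
  fixes p :: "'i \<Rightarrow> 'a \<Rightarrow> real" and Q :: "'a \<Rightarrow> 'a measure measure"
  assumes weight_measurable [measurable]: "i \<in> I \<Longrightarrow> p i \<in> borel_measurable borel"
    and weight_nonneg: "i \<in> I \<Longrightarrow> 0 \<le> p i x"
    and weight_sum: "(\<Sum>i\<in>I. p i x) = 1"
    and weight_density: "i \<in> I \<Longrightarrow>
      density (moment_measure M sum_process) (\<lambda>x. ennreal (p i x)) = moment_measure M (\<Phi> i)"
    and palm_sum_process: "palm_family M sum_process Q"
begin

text \<open>As a bind, the weighted sum of laws is a measure by construction, so it can itself be
  tested for being a Palm family.\<close>

definition mixture :: "'a \<Rightarrow> 'a measure measure" where
  "mixture x = point_measure I (\<lambda>j. ennreal (p j x)) \<bind> (\<lambda>j. component_law j x)"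

lemma weight_sum_ennreal: "(\<Sum>j\<in>I. ennreal (p j x)) = 1"
  using weight_nonneg weight_sum by (simp add: sum_ennreal)

lemma index_nonempty: "I \<noteq> {}"
  using weight_sum[of undefined] by auto

lemma component_law_prob:
  assumes "j \<in> I"
  shows "component_law j x \<in> space (prob_algebra counting_algebra)"
  using component_law_kernel[OF assms] by (rule measurable_space) simp

lemma mixture_sets: "sets (mixture x) = sets counting_algebra"
  unfolding mixture_def using index_nonempty
  by (intro sets_bind) (auto simp: space_point_measure)

lemma emeasure_mixture:
  assumes L: "L \<in> sets counting_algebra"
  shows "emeasure (mixture x) L = (\<Sum>j\<in>I. ennreal (p j x) * emeasure (component_law j x) L)"
proof -
  have "(\<lambda>j. component_law j x) \<in> point_measure I (\<lambda>j. ennreal (p j x)) \<rightarrow>\<^sub>M subprob_algebra counting_algebra"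
    using component_law_prob
    by (auto simp: measurable_def space_point_measure sets_point_measure space_prob_algebra
        space_subprob_algebra prob_space_imp_subprob_space)
  from emeasure_bind[OF _ this L] show ?thesis
    using index_nonempty finite_index
    by (simp add: mixture_def space_point_measure nn_integral_point_measure_finite)
qed

lemma mixture_kernel: "mixture \<in> borel \<rightarrow>\<^sub>M prob_algebra counting_algebra"
proof (rule measurable_prob_algebraI)
  show prob: "prob_space (mixture x)" for x
  proof
    have "emeasure (mixture x) (space (mixture x)) = (\<Sum>j\<in>I. ennreal (p j x) * 1)"
      unfolding sets_eq_imp_space_eq[OF mixture_sets] using component_law_prob
      by (subst emeasure_mixture) (auto intro!: sum.cong simp: in_space_prob_algebra)
    then show "emeasure (mixture x) (space (mixture x)) = 1" by (simp add: weight_sum_ennreal)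
  qed
  show "mixture \<in> borel \<rightarrow>\<^sub>M subprob_algebra counting_algebra"
  proof (rule measurable_subprob_algebra)
    fix L :: "'a measure set" assume L: "L \<in> sets counting_algebra"
    have "(\<lambda>x. emeasure (component_law j x) L) \<in> borel_measurable borel" if "j \<in> I" for j
      using measurable_prob_algebraD[OF component_law_kernel[OF that]] L
      by (rule measurable_emeasure_kernel)
    then show "(\<lambda>x. emeasure (mixture x) L) \<in> borel_measurable borel"
      unfolding emeasure_mixture[OF L]
      by (intro borel_measurable_sum borel_measurable_times_ennreal
          measurable_compose[OF weight_measurable measurable_ennreal])
  qed (simp_all add: prob prob_space_imp_subprob_space mixture_sets)
qed

lemma mixture_palm_family: "palm_family M sum_process mixture"
  unfolding palm_family_def
proof (intro conjI mixture_kernel ballI)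
  fix B :: "'a set" and L :: "'a measure set"
  assume B [measurable]: "B \<in> sets borel" and L [measurable]: "L \<in> sets counting_algebra"
  have [measurable]: "(\<lambda>x. emeasure (component_law j x) L) \<in> borel_measurable borel" if "j \<in> I" for j
    using measurable_prob_algebraD[OF component_law_kernel[OF that]] L
    by (rule measurable_emeasure_kernel)
  have m: "(\<lambda>\<omega>. emeasure (\<Phi> j \<omega>) B * indicator L (sum_process \<omega>)) \<in> borel_measurable M" if "j \<in> I" for j
  proof -
    note [measurable] = point_process[OF that] sum_process_measurable
    show ?thesis by measurable
  qed
  have "emeasure (campbell_measure M sum_process) (B \<times> L) =
      (\<integral>\<^sup>+\<omega>. (\<Sum>j\<in>I. emeasure (\<Phi> j \<omega>) B * indicator L (sum_process \<omega>)) \<partial>M)"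
    unfolding emeasure_campbell_measure[OF sum_process_measurable B L]
    by (intro nn_integral_cong)
      (simp add: emeasure_superposition sets_point_process[OF point_process] B sum_distrib_right)
  also have "\<dots> = (\<Sum>j\<in>I. \<integral>\<^sup>+x\<in>B. emeasure (component_law j x) L \<partial>moment_measure M (\<Phi> j))"
    using m by (subst nn_integral_sum) (auto intro!: sum.cong component_disintegration B L)
  \<comment> \<open>The weight \<open>p j\<close> converts the moment measure of
    \<open>\<Phi> j\<close> into that of the sum, so that all terms share one base measure.\<close>
  also have "\<dots> = (\<Sum>j\<in>I. \<integral>\<^sup>+x\<in>B. ennreal (p j x) * emeasure (component_law j x) L \<partial>moment_measure M sum_process)"
    by (intro sum.cong refl, subst weight_density[symmetric])
      (auto simp: nn_integral_density mult.assoc)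
  also have "\<dots> = (\<integral>\<^sup>+x\<in>B. emeasure (mixture x) L \<partial>moment_measure M sum_process)"
    by (subst nn_integral_sum[symmetric])
      (auto simp: emeasure_mixture[OF L] sum_distrib_right intro!: nn_integral_cong)
  finally show "emeasure (campbell_measure M sum_process) (B \<times> L) =
    (\<integral>\<^sup>+x\<in>B. emeasure (mixture x) L \<partial>moment_measure M sum_process)" .
qed

text \<open>The moment measure of \<open>\<Phi> j\<close> has density \<open>p j\<close>, so its
  null sets are null for the sum where \<open>p j\<close> is positive and say nothing
  elsewhere.\<close>

lemma AE_component:
  assumes j: "j \<in> I" and R: "AE x in moment_measure M (\<Phi> j). R x"
  shows "AE x in moment_measure M sum_process. 0 < p j x \<longrightarrow> R x"
proof -
  have "AE x in density (moment_measure M sum_process) (\<lambda>x. ennreal (p j x)). R x"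
    using R by (subst weight_density[OF j])
  then show ?thesis using j by (subst (asm) AE_density) auto
qed

text \<open>Uniqueness is applied once per \<open>j\<close> with \<open>q = p j\<close>, where the
  weighted measure is the \<sigma>-finite moment measure of \<open>\<Phi> j\<close>. The sets
  \<open>{x. 0 < p j x}\<close> cover the space because the weights sum to \<open>1\<close>.\<close>

lemma palm_sum_process_eq_mixture: "AE x in moment_measure M sum_process. Q x = mixture x"
proof -
  have "AE x in moment_measure M sum_process. \<forall>j\<in>I. 0 < p j x \<longrightarrow> Q x = mixture x"
  proof (rule AE_finite_allI[OF finite_index])
    fix j assume j: "j \<in> I"
    have "AE x in density (moment_measure M sum_process) (\<lambda>x. ennreal (p j x)). Q x = mixture x"
      using j by (intro palm_family_unique sum_process_measurable palm_sum_process mixture_palm_family)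
        (simp_all add: weight_density sigma_finite_moment)
    then show "AE x in moment_measure M sum_process. 0 < p j x \<longrightarrow> Q x = mixture x"
      by (intro AE_component j) (simp only: weight_density[OF j])
  qed
  then show ?thesis
  proof eventually_elim
    case (elim x)
    have "\<exists>j\<in>I. 0 < p j x"
    proof (rule ccontr)
      assume "\<not> ?thesis"
      then have "(\<Sum>j\<in>I. p j x) \<le> 0" by (intro sum_nonpos) (auto simp: not_less)
      then show False by (simp add: weight_sum)
    qed
    with elim show ?case by blast
  qed
qed

lemma palm_sum_process_mixture:
  "AE x in moment_measure M sum_process. \<forall>L\<in>sets counting_algebra.
    emeasure (Q x) L = (\<Sum>j\<in>I. ennreal (p j x) * emeasure (component_law j x) L)"
  using palm_sum_process_eq_mixture by eventually_elim (simp add: emeasure_mixture)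

section \<open>Reduced Palm versions\<close>

text \<open>Given an almost sure atom at \<open>x\<close> in the inserted measure, removal from the
  sum agrees almost surely with removal from that measure, and maps equal almost everywhere have the
  same image law.\<close>

lemma distr_remove_point_component_law:
  assumes j: "j \<in> I" and atom: "AE \<mu> in P j x. 1 \<le> emeasure \<mu> {x}"
  shows "distr (component_law j x) counting_algebra (remove_point x) =
    distr (P j x \<Otimes>\<^sub>M M) counting_algebra
      (\<lambda>(\<mu>, \<omega>). superposition I ((\<lambda>i. \<Phi> i \<omega>)(j := remove_point x \<mu>)))"
proof -
  note kernel = palm_family_kernel[OF palm[OF j], of x]
  interpret Px: prob_space "P j x" by (rule kernel)
  have T: "resample j \<in> P j x \<Otimes>\<^sub>M M \<rightarrow>\<^sub>M counting_algebra"
    using resample_measurable[of j] kernel(2) by (simp cong: measurable_cong_sets sets_pair_measure_cong)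
  have [measurable]: "remove_point x \<in> P j x \<rightarrow>\<^sub>M counting_algebra"
    using measurable_remove_point kernel(2) by (simp cong: measurable_cong_sets)
  have "(\<lambda>z. (remove_point x (fst z), snd z)) \<in> P j x \<Otimes>\<^sub>M M \<rightarrow>\<^sub>M counting_algebra \<Otimes>\<^sub>M M"
    by measurable
  from measurable_compose[OF this resample_measurable[of j]]
  have T': "(\<lambda>(\<mu>, \<omega>). superposition I ((\<lambda>i. \<Phi> i \<omega>)(j := remove_point x \<mu>)))
      \<in> P j x \<Otimes>\<^sub>M M \<rightarrow>\<^sub>M counting_algebra"
    by (simp add: split_beta')
  \<comment> \<open>\<open>P j x\<close> is the first marginal of the product because
    \<open>M\<close> is a probability measure; this lifts the atom condition to pairs.\<close>
  have "AE \<mu> in distr (P j x \<Otimes>\<^sub>M M) (P j x) fst. 1 \<le> emeasure \<mu> {x}"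
    using atom by (subst distr_pair_fst)
  then have "AE z in P j x \<Otimes>\<^sub>M M. 1 \<le> emeasure (fst z) {x}"
    by (rule AE_distrD[rotated]) simp
  then have "AE z in P j x \<Otimes>\<^sub>M M. remove_point x (resample j z) =
      (case z of (\<mu>, \<omega>) \<Rightarrow> superposition I ((\<lambda>i. \<Phi> i \<omega>)(j := remove_point x \<mu>)))"
    using AE_space
  proof eventually_elim
    case (elim z)
    obtain \<mu> \<omega> where z: "z = (\<mu>, \<omega>)" by (cases z)
    have "\<mu> \<in> counting_measures" "\<omega> \<in> space M"
      using elim kernel(3) by (auto simp: z space_pair_measure)
    then have "remove_point x (superposition I ((\<lambda>i. \<Phi> i \<omega>)(j := \<mu>))) =
        superposition I (((\<lambda>i. \<Phi> i \<omega>)(j := \<mu>))(j := remove_point x (((\<lambda>i. \<Phi> i \<omega>)(j := \<mu>)) j)))"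
      using elim by (intro remove_point_superposition finite_index j)
        (auto simp: z sets_counting_measures sets_point_process[OF point_process])
    then show ?case by (simp add: z)
  qed
  then have "distr (P j x \<Otimes>\<^sub>M M) counting_algebra (\<lambda>z. remove_point x (resample j z)) =
      distr (P j x \<Otimes>\<^sub>M M) counting_algebra
        (\<lambda>(\<mu>, \<omega>). superposition I ((\<lambda>i. \<Phi> i \<omega>)(j := remove_point x \<mu>)))"
    using measurable_compose[OF T measurable_remove_point] T' by (intro distr_cong_AE) auto
  then show ?thesis
    by (simp add: distr_distr[OF measurable_remove_point T] comp_def)
qed

text \<open>For fixed \<open>x\<close>, taking images under \<open>remove_point x\<close> commutes
  with forming the mixture, so the unreduced statement can be pushed forward term by term.\<close>

lemma reduced_palm_sum_process:
  "AE x in moment_measure M sum_process. \<forall>L\<in>sets counting_algebra.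
    emeasure (distr (Q x) counting_algebra (remove_point x)) L =
    (\<Sum>j\<in>I. ennreal (p j x) * emeasure (distr (P j x \<Otimes>\<^sub>M M) counting_algebra
      (\<lambda>(\<mu>, \<omega>). superposition I ((\<lambda>i. \<Phi> i \<omega>)(j := remove_point x \<mu>)))) L)"
proof -
  have "AE x in moment_measure M sum_process. \<forall>j\<in>I. 0 < p j x \<longrightarrow> (AE \<mu> in P j x. 1 \<le> emeasure \<mu> {x})"
    by (intro AE_finite_allI finite_index AE_component palm_family_atom point_process palm)
  with palm_sum_process_eq_mixture show ?thesis
  proof eventually_elim
    case (elim x)
    show ?case
    proof
      fix L :: "'a measure set" assume L: "L \<in> sets counting_algebra"
      let ?L = "remove_point x -` L \<inter> space counting_algebra"
      have L': "?L \<in> sets counting_algebra" using measurable_remove_point L by (rule measurable_sets)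
      have d: "emeasure (distr N counting_algebra (remove_point x)) L = emeasure N ?L"
        if "sets N = sets counting_algebra" for N :: "'a measure measure"
        using measurable_remove_point[of x] that sets_eq_imp_space_eq[OF that]
        by (subst emeasure_distr[OF _ L]) (simp_all cong: measurable_cong_sets)
      have "emeasure (distr (Q x) counting_algebra (remove_point x)) L = emeasure (mixture x) ?L"
        using elim mixture_sets by (simp add: d)
      also have "\<dots> = (\<Sum>j\<in>I. ennreal (p j x) *
          emeasure (distr (component_law j x) counting_algebra (remove_point x)) L)"
        by (subst emeasure_mixture[OF L']) (simp add: d)
      also have "\<dots> = (\<Sum>j\<in>I. ennreal (p j x) * emeasure (distr (P j x \<Otimes>\<^sub>M M) counting_algebra
          (\<lambda>(\<mu>, \<omega>). superposition I ((\<lambda>i. \<Phi> i \<omega>)(j := remove_point x \<mu>)))) L)"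
      proof (intro sum.cong refl)
        fix j assume j: "j \<in> I"
        show "ennreal (p j x) * emeasure (distr (component_law j x) counting_algebra (remove_point x)) L =
          ennreal (p j x) * emeasure (distr (P j x \<Otimes>\<^sub>M M) counting_algebra
            (\<lambda>(\<mu>, \<omega>). superposition I ((\<lambda>i. \<Phi> i \<omega>)(j := remove_point x \<mu>)))) L"
        \<comment> \<open>The atom is known only where \<open>p j x\<close> is positive; a vanishing
          weight makes both sides \<open>0\<close>.\<close>
        proof (cases "0 < p j x")
          case True
          with elim j show ?thesis by (simp only: distr_remove_point_component_law)
        next
          case False
          then show ?thesis using weight_nonneg[OF j, of x] by simp
        qed
      qed
      finally show "emeasure (distr (Q x) counting_algebra (remove_point x)) L =
        (\<Sum>j\<in>I. ennreal (p j x) * emeasure (distr (P j x \<Otimes>\<^sub>M M) counting_algebra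
          (\<lambda>(\<mu>, \<omega>). superposition I ((\<lambda>i. \<Phi> i \<omega>)(j := remove_point x \<mu>)))) L)" .
    qed
  qed
qed

end

theorem corollary1:
  fixes M :: "'w measure"
    and \<Phi> :: "nat \<Rightarrow> 'w \<Rightarrow> 'a::polish_space measure"
    and k :: nat
    and p :: "nat \<Rightarrow> 'a \<Rightarrow> real"
    and P :: "'a \<Rightarrow> 'a measure measure"
    and Pj :: "nat \<Rightarrow> 'a \<Rightarrow> 'a measure measure"
  defines "\<Phi>sum \<equiv> \<lambda>\<omega>. superposition {1..k} (\<lambda>j. \<Phi> j \<omega>)"
  assumes "prob_space M"
    and "1 \<le> k"
    and "\<And>j. j \<in> {1..k} \<Longrightarrow> \<Phi> j \<in> M \<rightarrow>\<^sub>M counting_algebra"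
    and "prob_space.indep_vars M (\<lambda>_. counting_algebra) \<Phi> {1..k}"
    and "\<And>j. j \<in> {1..k} \<Longrightarrow> sigma_finite_measure (moment_measure M (\<Phi> j))"
    and "\<And>j. j \<in> {1..k} \<Longrightarrow> p j \<in> borel_measurable borel"
    and "\<And>j x. j \<in> {1..k} \<Longrightarrow> 0 \<le> p j x"
    and "\<And>x. (\<Sum>j=1..k. p j x) = 1"
    and "\<And>j. j \<in> {1..k} \<Longrightarrow>
           density (moment_measure M \<Phi>sum) (\<lambda>x. ennreal (p j x)) = moment_measure M (\<Phi> j)"
    and "palm_family M \<Phi>sum P"
    and "\<And>j. j \<in> {1..k} \<Longrightarrow> palm_family M (\<Phi> j) (Pj j)"
  shows "(AE x in moment_measure M \<Phi>sum. \<forall>L\<in>sets counting_algebra.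
            emeasure (P x) L =
            (\<Sum>j=1..k. ennreal (p j x) *
               emeasure (distr (Pj j x \<Otimes>\<^sub>M M) counting_algebra
                 (\<lambda>(\<mu>, \<omega>). superposition {1..k} ((\<lambda>l. \<Phi> l \<omega>)(j := \<mu>)))) L))
       \<and> (AE x in moment_measure M \<Phi>sum. \<forall>L\<in>sets counting_algebra.
            emeasure (distr (P x) counting_algebra (remove_point x)) L =
            (\<Sum>j=1..k. ennreal (p j x) *
               emeasure (distr (Pj j x \<Otimes>\<^sub>M M) counting_algebra
                 (\<lambda>(\<mu>, \<omega>). superposition {1..k} ((\<lambda>l. \<Phi> l \<omega>)(j := remove_point x \<mu>)))) L))"
proof -
  interpret superposition_palm M "{1..k}" \<Phi> Pj p P
    using assms
    by (intro superposition_palm.intro independent_point_processes.intro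
        independent_point_processes_axioms.intro superposition_palm_axioms.intro) simp_all
  show ?thesis
    using palm_sum_process_mixture reduced_palm_sum_process unfolding \<Phi>sum_def by (rule conjI)
qed

end
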